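(* Let $p\ge 1$ and $1\le\ell\le p$ be integers, let $f\in\mathcal E_p$ with zeros $-\lambda_m$ ($0\le\lambda_1\le\lambda_2\le\cdots$, counted with multiplicity), and let $0\le a_1\le\cdots\le a_n$ and $0\le b_1\le\cdots\le b_n$ be real numbers such that $\sum_{k=1}^n a_k^j=\sum_{k=1}^n b_k^j$ for all integers $0\le j\le\ell$. Let $W_f(z)=\prod_{k=1}^n f(z+a_k)\big/\prod_{k=1}^n f(z+b_k)$, and put $h(s)=\sum_{m\ge1}e^{-\lambda_m s}$, $$g_\ell(s)=\frac{\sum_{k=1}^n e^{-sa_k}-\sum_{k=1}^n e^{-sb_k}}{s^{1+\ell}}\qquad(s>0),$$ $$\rho_\ell(t)=\sum_{k=1}^n (t-a_k)^\ell\mathbf 1_{[a_k,\infty)}(t)-\sum_{k=1}^n (t-b_k)^\ell\mathbf 1_{[b_k,\infty)}(t),\qquad \phi_\ell(t)=\sum_{m\ge 1}\rho_\ell(t-\lambda_m).$$ Then for all $z$ with $\Re z>0$, $$(-1)^{p-\ell+1}\partial_z^{p-\ell}\log W_f(z)=\int_0^\infty e^{-sz}s^{p}h(s)g_\ell(s)\,ds=\frac{\Gamma(p+1)}{\ell!}\int_0^\infty\frac{\phi_\ell(t)\,dt}{(z+t)^{p+1}}.$$ Thus, if $\rho_\ell$ is non-negative, then $(-1)^{p-\ell+1}\partial_z^{p-\ell}\log W_f(z)$ is a generalised Stieltjes function of order $p+1$.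
   Context: $\mathcal E_p$ denotes the class of entire functions $f$ that are real on the real axis, of genus $p$, have only real and non-positive zeros, and satisfy $f(x)>0$ for $x>0$. The zeros are written $-\lambda_m$, listed with multiplicity, and sums over $m$ run over all zeros. $\log f$ denotes the holomorphic branch on $\mathbb C\setminus(-\infty,0]$ that is real on $(0,\infty)$, and $\log W_f(z)=\sum_{k=1}^n(\log f(z+a_k)-\log f(z+b_k))$. $\partial_z$ is differentiation with respect to $z$ (with $\partial_z^0$ the identity), $\mathbf 1_S$ is the indicator function of $S$, and $0^0=1$ in the power sums. A function $F$ on $(0,\infty)$ is a generalised Stieltjes function of order $\lambda>0$ if $F(x)=\int_0^\infty \frac{d\mu(t)}{(t+x)^\lambda}+c$ for all $x>0$, for some positive (i.e. non-negative) measure $\mu$ on $[0,\infty)$ making the integral converge and some $c\ge 0$. A function of a complex variable is called generalised Stieltjes if its restriction to $(0,\infty)$ is. *)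

theory Defs
  imports "HOL-Complex_Analysis.Complex_Analysis"
begin

text \<open>
  The zeros of an entire function may be infinite or finite in number (or absent), so lists
  of zeros are indexed by the positive integers up to some extended natural number \<open>N\<close>.
\<close>

definition index_set :: "enat \<Rightarrow> nat set" where
  "index_set N = {m. 1 \<le> m \<and> enat m \<le> N}"

text \<open>
  \<open>hadamard_rep p f\<close> says that
  \<open>f(z) = z^r exp(Q(z)) \<Prod>\<^sub>m E\<^sub>p(z / c\<^sub>m)\<close> with \<open>Q\<close> a polynomial of degree at most \<open>p\<close>
  and \<open>\<Sum>\<^sub>m |c\<^sub>m|^(-p-1) < \<infinity>\<close>, where \<open>E\<^sub>p\<close> is the elementary factor (\<open>weierstrass_factor\<close>).
  The genus of \<open>f\<close> is the least \<open>p\<close> for which there is such a representation.  The summability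
  condition forces absolute convergence of the product.
\<close>

definition hadamard_rep :: "nat \<Rightarrow> (complex \<Rightarrow> complex) \<Rightarrow> bool" where
  "hadamard_rep p f \<longleftrightarrow>
     (\<exists>(r::nat) (Q::complex poly) (N::enat) (c::nat \<Rightarrow> complex).
        degree Q \<le> p \<and>
        (\<forall>m\<in>index_set N. c m \<noteq> 0) \<and>
        (\<lambda>m. 1 / norm (c m) ^ (p + 1)) summable_on index_set N \<and>
        (\<forall>z. f z = z ^ r * exp (poly Q z) *
               (\<Prod>m. if m \<in> index_set N then weierstrass_factor p (z / c m) else 1)))"

definition has_genus :: "(complex \<Rightarrow> complex) \<Rightarrow> nat \<Rightarrow> bool" where
  "has_genus f p \<longleftrightarrow> hadamard_rep p f \<and> (\<forall>q<p. \<not> hadamard_rep q f)"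

definition class_E :: "nat \<Rightarrow> (complex \<Rightarrow> complex) set" where
  "class_E p = {f. f holomorphic_on UNIV \<and>
     (\<forall>x::real. f (of_real x) \<in> \<real>) \<and>
     has_genus f p \<and>
     (\<forall>w. f w = 0 \<longrightarrow> w \<in> \<real>\<^sub>\<le>\<^sub>0) \<and>
     (\<forall>x::real. x > 0 \<longrightarrow> Re (f (of_real x)) > 0)}"

text \<open>The zeros of \<open>f\<close> are the numbers \<open>- lam m\<close>, each listed according to its multiplicity.\<close>

definition lists_zeros :: "(complex \<Rightarrow> complex) \<Rightarrow> enat \<Rightarrow> (nat \<Rightarrow> real) \<Rightarrow> bool" where
  "lists_zeros f N lam \<longleftrightarrow>
     (\<forall>w. finite {m \<in> index_set N. - of_real (lam m) = w} \<and>
          int (card {m \<in> index_set N. - of_real (lam m) = w}) = (if f w = 0 then zorder f w else 0))"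

definition is_log_branch :: "(complex \<Rightarrow> complex) \<Rightarrow> (complex \<Rightarrow> complex) \<Rightarrow> bool" where
  "is_log_branch f L \<longleftrightarrow>
     L holomorphic_on (- \<real>\<^sub>\<le>\<^sub>0) \<and>
     (\<forall>z \<in> - \<real>\<^sub>\<le>\<^sub>0. exp (L z) = f z) \<and>
     (\<forall>x::real. x > 0 \<longrightarrow> L (of_real x) \<in> \<real>)"

definition log_branch :: "(complex \<Rightarrow> complex) \<Rightarrow> complex \<Rightarrow> complex" where
  "log_branch f = (SOME L. is_log_branch f L)"

definition W :: "(complex \<Rightarrow> complex) \<Rightarrow> nat \<Rightarrow> (nat \<Rightarrow> real) \<Rightarrow> (nat \<Rightarrow> real) \<Rightarrow> complex \<Rightarrow> complex" where
  "W f n a b z = (\<Prod>k=1..n. f (z + of_real (a k))) / (\<Prod>k=1..n. f (z + of_real (b k)))"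

definition log_W :: "(complex \<Rightarrow> complex) \<Rightarrow> nat \<Rightarrow> (nat \<Rightarrow> real) \<Rightarrow> (nat \<Rightarrow> real) \<Rightarrow> complex \<Rightarrow> complex" where
  "log_W f n a b z =
     (\<Sum>k=1..n. log_branch f (z + of_real (a k)) - log_branch f (z + of_real (b k)))"

definition h_sum :: "enat \<Rightarrow> (nat \<Rightarrow> real) \<Rightarrow> real \<Rightarrow> real" where
  "h_sum N lam s = (\<Sum>\<^sub>\<infinity>m\<in>index_set N. exp (- lam m * s))"

definition g_fun :: "nat \<Rightarrow> nat \<Rightarrow> (nat \<Rightarrow> real) \<Rightarrow> (nat \<Rightarrow> real) \<Rightarrow> real \<Rightarrow> real" where
  "g_fun l n a b s = ((\<Sum>k=1..n. exp (- s * a k)) - (\<Sum>k=1..n. exp (- s * b k))) / s ^ (1 + l)"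

definition rho :: "nat \<Rightarrow> nat \<Rightarrow> (nat \<Rightarrow> real) \<Rightarrow> (nat \<Rightarrow> real) \<Rightarrow> real \<Rightarrow> real" where
  "rho l n a b t =
     (\<Sum>k=1..n. (t - a k) ^ l * indicator {a k..} t) -
     (\<Sum>k=1..n. (t - b k) ^ l * indicator {b k..} t)"

definition phi :: "enat \<Rightarrow> (nat \<Rightarrow> real) \<Rightarrow> nat \<Rightarrow> nat \<Rightarrow> (nat \<Rightarrow> real) \<Rightarrow> (nat \<Rightarrow> real) \<Rightarrow> real \<Rightarrow> real" where
  "phi N lam l n a b t = (\<Sum>\<^sub>\<infinity>m\<in>index_set N. rho l n a b (t - lam m))"

definition gen_stieltjes :: "real \<Rightarrow> (real \<Rightarrow> real) \<Rightarrow> bool" where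
  "gen_stieltjes \<alpha> F \<longleftrightarrow> \<alpha> > 0 \<and>
     (\<exists>(\<mu>::real measure) c. sets \<mu> = sets (restrict_space borel {0..}) \<and> c \<ge> 0 \<and>
        (\<forall>x>0. integrable \<mu> (\<lambda>t. 1 / (t + x) powr \<alpha>) \<and>
               F x = (LINT t|\<mu>. 1 / (t + x) powr \<alpha>) + c))"

definition gen_stieltjes_complex :: "real \<Rightarrow> (complex \<Rightarrow> complex) \<Rightarrow> bool" where
  "gen_stieltjes_complex \<alpha> F \<longleftrightarrow>
     (\<exists>G. gen_stieltjes \<alpha> G \<and> (\<forall>x::real. x > 0 \<longrightarrow> F (of_real x) = of_real (G x)))"

text \<open>The branch exists, so \<open>log_branch\<close> and \<open>log_W\<close> are what their names say.\<close>

lemma is_log_branch_log_branch: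
  assumes "f \<in> class_E p"
  shows "is_log_branch f (log_branch f)"
proof -
  have hol: "f holomorphic_on UNIV" and re: "\<And>x::real. f (of_real x) \<in> \<real>"
    and nz: "\<And>w. f w = 0 \<Longrightarrow> w \<in> \<real>\<^sub>\<le>\<^sub>0"
    and pos: "\<And>x::real. x > 0 \<Longrightarrow> Re (f (of_real x)) > 0"
    using assms by (auto simp: class_E_def)
  have eq: "- \<real>\<^sub>\<le>\<^sub>0 = - (complex_of_real ` {..0})"
    by (auto simp: nonpos_Reals_def image_iff)
  have "simply_connected (- \<real>\<^sub>\<le>\<^sub>0 :: complex set)"
    unfolding eq by (intro starlike_imp_simply_connected starlike_slotted_complex_plane_left)
  moreover have "locally path_connected (- \<real>\<^sub>\<le>\<^sub>0 :: complex set)"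
    by (intro open_imp_locally_path_connected open_Compl closed_nonpos_Reals_complex)
  moreover have "f holomorphic_on - \<real>\<^sub>\<le>\<^sub>0"
    using hol by (rule holomorphic_on_subset) simp
  moreover have "f z \<noteq> 0" if "z \<in> - \<real>\<^sub>\<le>\<^sub>0" for z
    using nz[of z] that by blast
  ultimately obtain g where g: "g holomorphic_on - \<real>\<^sub>\<le>\<^sub>0" "\<And>z. z \<in> - \<real>\<^sub>\<le>\<^sub>0 \<Longrightarrow> f z = exp (g z)"
    using simply_connected_imp_holomorphic_log[of f "- \<real>\<^sub>\<le>\<^sub>0"] by blast
  have mem: "of_real x \<in> - (\<real>\<^sub>\<le>\<^sub>0 :: complex set)" if "x > 0" for x :: real
    using that by auto
  have ex: "\<exists>k::int. Im (g (of_real x)) = 2 * pi * of_int k" if "x > 0" for x :: real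
  proof -
    let ?w = "g (of_real x)"
    have e: "exp ?w = f (of_real x)" using g(2)[OF mem[OF that]] by simp
    have "Re (exp ?w) > 0" "Im (exp ?w) = 0"
      using pos[OF that] re[of x] e by (auto simp: complex_is_Real_iff)
    then have "cos (Im ?w) > 0" "sin (Im ?w) = 0"
      by (auto simp: Re_exp Im_exp zero_less_mult_iff)
    then have "cos (Im ?w) = 1"
      using sin_zero_abs_cos_one[of "Im ?w"] by simp
    then show ?thesis
      using cos_one_2pi_int[of "Im ?w"] by (auto simp: mult_ac)
  qed
  have cont: "continuous_on {0<..} (\<lambda>x::real. Im (g (of_real x)))"
    by (intro continuous_intros continuous_on_compose2[OF holomorphic_on_imp_continuous_on[OF g(1)]])
       auto
  have "(\<lambda>x::real. Im (g (of_real x))) constant_on {0<..}"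
  proof (rule continuous_discrete_range_constant[OF _ cont])
    fix x :: real assume x: "x \<in> {0<..}"
    show "\<exists>e>0. \<forall>y. y \<in> {0<..} \<and> Im (g (of_real y)) \<noteq> Im (g (of_real x)) \<longrightarrow>
              e \<le> norm (Im (g (of_real y)) - Im (g (of_real x)))"
    proof (intro exI[of _ "2 * pi"] conjI allI impI)
      fix y :: real assume y: "y \<in> {0<..} \<and> Im (g (of_real y)) \<noteq> Im (g (of_real x))"
      obtain i j :: int where ij: "Im (g (of_real x)) = 2 * pi * of_int i"
        "Im (g (of_real y)) = 2 * pi * of_int j"
        using ex x y by (metis greaterThan_iff)
      with y have "i \<noteq> j" by auto
      then have "1 \<le> \<bar>real_of_int (j - i)\<bar>" by linarith
      moreover have "norm (Im (g (of_real y)) - Im (g (of_real x))) = 2 * pi * \<bar>real_of_int (j - i)\<bar>"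
      proof -
        have "Im (g (of_real y)) - Im (g (of_real x)) = 2 * pi * real_of_int (j - i)"
          unfolding ij by (simp add: right_diff_distrib)
        then show ?thesis by (simp only: real_norm_def abs_mult) simp
      qed
      ultimately show "2 * pi \<le> norm (Im (g (of_real y)) - Im (g (of_real x)))"
        by simp
    qed simp
  qed simp
  then obtain c where c: "\<And>x::real. x > 0 \<Longrightarrow> Im (g (of_real x)) = c"
    by (auto simp: constant_on_def)
  obtain k :: int where k: "c = 2 * pi * of_int k"
    using ex[of 1] c[of 1] by auto
  have e1: "exp (\<i> * of_real c) = 1"
    unfolding k using exp_integer_2pi[of "of_int k"] by (simp add: mult_ac)
  have "is_log_branch f (\<lambda>z. g z - \<i> * of_real c)"
    unfolding is_log_branch_def
    using g c e1 by (auto intro!: holomorphic_intros simp: exp_diff complex_is_Real_iff)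
  then show ?thesis
    unfolding log_branch_def by (rule someI[of "is_log_branch f"])
qed

lemma exp_log_W:
  assumes "f \<in> class_E p" "\<forall>k\<in>{1..n}. 0 \<le> a k" "\<forall>k\<in>{1..n}. 0 \<le> b k" "Re z > 0"
  shows "exp (log_W f n a b z) = W f n a b z"
proof -
  have "z + of_real x \<in> - \<real>\<^sub>\<le>\<^sub>0" if "x \<ge> 0" for x
    using that assms(4) by (auto simp: complex_nonpos_Reals_iff)
  then have "exp (log_branch f (z + of_real x)) = f (z + of_real x)" if "x \<ge> 0" for x
    using is_log_branch_log_branch[OF assms(1)] that by (auto simp: is_log_branch_def)
  then show ?thesis
    using assms(2,3) unfolding log_W_def W_def
    by (simp add: exp_sum exp_diff prod_dividef)
qed

end

theory Submission
  imports Defs "HOL-Real_Asymp.Real_Asymp"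
begin

text \<open>
  Write \<open>L\<close> for \<open>log f\<close>, \<open>F = \<partial>\<^sup>p\<^sup>-\<^sup>l L\<close> and \<open>\<rho>\<close>, \<open>\<phi>\<close> for \<open>rho l n a b\<close>, \<open>phi N lam l n a b\<close>.  The whole
  statement comes from two facts.

  First, \<open>p + 1\<close> derivatives kill everything in the Hadamard product of \<open>f\<close> except the poles: the
  exponent polynomial has degree at most \<open>p\<close>, each elementary factor \<open>E\<^sub>p(z/c)\<close> is \<open>1 - z/c\<close> times the
  exponential of a polynomial of degree \<open>p\<close>, and so
  \<open>\<partial>\<^sup>p\<^sup>+\<^sup>1 L(z) = (-1)\<^sup>p p! \<Sum>\<^sub>m (z + \<lambda>\<^sub>m)\<^sup>-\<^sup>p\<^sup>-\<^sup>1\<close> (\<open>higher_deriv_log_branch\<close>).  It is obtained from the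
  locally uniform convergence of the logarithmic derivative of the canonical product, followed by
  a comparison of multiplicities which turns the sum over the zeros of the factorization into a
  sum over the given list \<open>\<lambda>\<^sub>m\<close>.

  Secondly, the functional \<open>F \<mapsto> \<Sum>\<^sub>k F(a\<^sub>k) - F(b\<^sub>k)\<close> annihilates polynomials of degree at most \<open>l\<close>,
  because the power sums agree, so it has a Peano kernel.  This kernel is \<open>\<rho>\<close> up to a constant, and the
  same power sum identities show that \<open>\<rho>\<close> has compact support (\<open>peano_kernel\<close>):
  \<open>\<Sum>\<^sub>k F(a\<^sub>k) - F(b\<^sub>k) = ((-1)\<^sup>l\<^sup>+\<^sup>1 / l!) \<integral> \<rho>(t) F\<^sup>(\<^sup>l\<^sup>+\<^sup>1\<^sup>)(t) dt\<close>.
  The compact support is what allows \<open>l = p\<close>, where \<open>F = L\<close> does not decay: no integral at infinity and no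
  constant of integration ever appears.

  Inserting the first fact into the second, with \<open>F\<close> shifted by \<open>z\<close>, expresses
  \<open>(-1)\<^sup>p\<^sup>-\<^sup>l\<^sup>+\<^sup>1 \<partial>\<^sup>p\<^sup>-\<^sup>l log W\<close> as \<open>p!/l!\<close> times \<open>\<integral> \<rho>(t) \<Sum>\<^sub>m (z + t + \<lambda>\<^sub>m)\<^sup>-\<^sup>p\<^sup>-\<^sup>1 dt\<close>, an integral equal to \<open>\<integral> \<phi>(t) (z + t)\<^sup>-\<^sup>p\<^sup>-\<^sup>1 dt\<close> after exchanging
  sum and integral and translating.  The Peano formula for \<open>F(t) = exp (- s t)\<close> says that the Laplace
  transform of \<open>\<rho>\<close> is \<open>l! g\<^sub>l\<close>, hence that of \<open>\<phi>\<close> is \<open>l! h g\<^sub>l\<close>, and writing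
  \<open>p! (z + t)\<^sup>-\<^sup>p\<^sup>-\<^sup>1\<close> as a Laplace integral and using Fubini gives the middle expression of the theorem.  If
  \<open>\<rho> \<ge> 0\<close>, then \<open>\<phi> \<ge> 0\<close>, and the representing measure has density \<open>(p!/l!) \<phi>\<close>.
\<close>

section \<open>Canonical products\<close>

text \<open>
  Since \<open>z / 0 = 0\<close> and \<open>E\<^sub>p(0) = 1\<close>, an index with \<open>c m = 0\<close> contributes the factor \<open>1\<close>.  So finite and
  infinite products, and products with some factors removed, are all of this one form, and
  \<open>1 / norm (c m)\<close> vanishes at such indices in the summability condition too.
\<close>

definition canonical_product :: "nat \<Rightarrow> (nat \<Rightarrow> complex) \<Rightarrow> complex \<Rightarrow> complex" where
  "canonical_product p c z = (\<Prod>m. weierstrass_factor p (z / c m))"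

text \<open>
  The terms of a convergent series tend to zero, so \<open>1 / norm (c m)\<close> eventually drops below
  \<open>1 / (2 R)\<close>.  This keeps \<open>z / c m\<close> in the disc where the elementary factors and their logarithmic
  derivatives are well controlled.
\<close>

lemma eventually_small_quotients:
  fixes c :: "nat \<Rightarrow> complex"
  assumes c: "summable (\<lambda>m. 1 / norm (c m) ^ Suc p)" and R: "R > 0"
  shows "\<forall>\<^sub>F m in sequentially. \<forall>z\<in>cball 0 R. norm (z / c m) \<le> 1 / 2"
proof -
  have "(\<lambda>m. 1 / norm (c m) ^ Suc p) \<longlonglongrightarrow> 0"
    using c by (rule summable_LIMSEQ_zero)
  then have "\<forall>\<^sub>F m in sequentially. 1 / norm (c m) ^ Suc p < (1 / (2 * R)) ^ Suc p"
    by (rule order_tendstoD) (use R in simp)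
  then show ?thesis
  proof eventually_elim
    case (elim m)
    have "(1 / norm (c m)) ^ Suc p < (1 / (2 * R)) ^ Suc p"
      using elim by (simp only: power_one_over)
    then have "1 / norm (c m) < 1 / (2 * R)"
      by (rule power_less_imp_less_base) (use R in simp)
    then have le: "1 / norm (c m) \<le> 1 / (2 * R)" by simp
    show ?case
    proof
      fix z :: complex assume "z \<in> cball 0 R"
      then have "norm z * (1 / norm (c m)) \<le> R * (1 / (2 * R))"
        using le R by (intro mult_mono) auto
      then show "norm (z / c m) \<le> 1 / 2"
        using R by (simp add: norm_divide)
    qed
  qed
qed

lemma canonical_product_bound:
  fixes c :: "nat \<Rightarrow> complex"
  assumes c: "summable (\<lambda>m. 1 / norm (c m) ^ Suc p)" and R: "R > 0"
  shows "\<forall>\<^sub>F m in sequentially. \<forall>z\<in>cball 0 R.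
           norm (weierstrass_factor p (z / c m) - 1) \<le> 3 * R ^ Suc p * (1 / norm (c m) ^ Suc p)"
  using eventually_small_quotients[OF c R]
proof eventually_elim
  case (elim m)
  show ?case
  proof
    fix z :: complex assume z: "z \<in> cball 0 R"
    have "norm (weierstrass_factor p (z / c m) - 1) \<le> 3 * norm (z / c m) ^ Suc p"
      using elim z by (intro weierstrass_factor_bound) blast
    also have "\<dots> = 3 * norm z ^ Suc p * (1 / norm (c m) ^ Suc p)"
      by (simp add: norm_divide power_divide)
    also have "\<dots> \<le> 3 * R ^ Suc p * (1 / norm (c m) ^ Suc p)"
      using z by (intro mult_right_mono mult_left_mono power_mono) auto
    finally show "norm (weierstrass_factor p (z / c m) - 1) \<le> 3 * R ^ Suc p * (1 / norm (c m) ^ Suc p)" .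
  qed
qed

lemma canonical_product_has_prod:
  fixes c :: "nat \<Rightarrow> complex"
  assumes c: "summable (\<lambda>m. 1 / norm (c m) ^ Suc p)"
  shows "(\<lambda>m. weierstrass_factor p (z / c m)) has_prod canonical_product p c z"
proof -
  have R: "norm z + 1 > 0" by (simp add: add_nonneg_pos)
  have "abs_convergent_prod (\<lambda>m. weierstrass_factor p (z / c m))"
    unfolding abs_convergent_prod_conv_summable
  proof (rule summable_comparison_test_ev)
    show "\<forall>\<^sub>F m in sequentially. norm (norm (weierstrass_factor p (z / c m) - 1)) \<le>
            3 * (norm z + 1) ^ Suc p * (1 / norm (c m) ^ Suc p)"
      using canonical_product_bound[OF c R] by eventually_elim auto
  qed (intro summable_mult c)
  then have "convergent_prod (\<lambda>m. weierstrass_factor p (z / c m))"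
    by (rule abs_convergent_prod_imp_convergent_prod)
  then show ?thesis
    unfolding canonical_product_def by (rule convergent_prod_has_prod)
qed

lemma canonical_product_uniform_limit:
  fixes c :: "nat \<Rightarrow> complex"
  assumes c: "summable (\<lambda>m. 1 / norm (c m) ^ Suc p)" and R: "R > 0"
  shows "uniform_limit (cball 0 R) (\<lambda>n z. \<Prod>m<n. weierstrass_factor p (z / c m))
           (canonical_product p c) sequentially"
proof -
  have "uniformly_convergent_on (cball 0 R) (\<lambda>n z. \<Prod>m<n. weierstrass_factor p (z / c m))"
  proof (rule uniformly_convergent_on_prod')
    show "uniformly_convergent_on (cball 0 R)
            (\<lambda>n z. \<Sum>m<n. norm (weierstrass_factor p (z / c m) - 1))"
    proof (rule Weierstrass_m_test'_ev)
      show "\<forall>\<^sub>F m in sequentially. \<forall>z\<in>cball 0 R. norm (norm (weierstrass_factor p (z / c m) - 1))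
              \<le> 3 * R ^ Suc p * (1 / norm (c m) ^ Suc p)"
        using canonical_product_bound[OF c R] by simp
    qed (intro summable_mult c)
    show "continuous_on (cball 0 R) (\<lambda>z. weierstrass_factor p (z / c m))" for m
      unfolding divide_inverse by (intro continuous_intros)
  qed simp
  then obtain g where
    g: "uniform_limit (cball 0 R) (\<lambda>n z. \<Prod>m<n. weierstrass_factor p (z / c m)) g sequentially"
    by (auto simp: uniformly_convergent_on_def)
  have "g z = canonical_product p c z" if "z \<in> cball 0 R" for z
    using tendsto_uniform_limitI[OF g that] has_prod_imp_tendsto'[OF canonical_product_has_prod[OF c]]
      LIMSEQ_unique by blast
  then show ?thesis
    using g by (subst uniform_limit_cong'[where g = "\<lambda>n z. \<Prod>m<n. weierstrass_factor p (z / c m)" and i = g]) auto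
qed

lemma holomorphic_weierstrass_factor_quotient:
  "(\<lambda>z. weierstrass_factor p (z / c)) holomorphic_on A"
  unfolding divide_inverse by (intro holomorphic_intros)

lemma canonical_product_holomorphic:
  fixes c :: "nat \<Rightarrow> complex"
  assumes c: "summable (\<lambda>m. 1 / norm (c m) ^ Suc p)"
  shows "canonical_product p c holomorphic_on A"
proof (rule holomorphic_on_subset)
  show "canonical_product p c holomorphic_on UNIV"
  proof (rule holomorphic_uniform_sequence)
    fix z :: complex
    have "uniform_limit (cball 0 (norm z + 1)) (\<lambda>n z. \<Prod>m<n. weierstrass_factor p (z / c m))
            (canonical_product p c) sequentially"
      by (rule canonical_product_uniform_limit[OF c]) (simp add: add_nonneg_pos)
    then have "uniform_limit (cball z 1) (\<lambda>n z. \<Prod>m<n. weierstrass_factor p (z / c m))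
            (canonical_product p c) sequentially"
      by (rule uniform_limit_on_subset) (simp add: cball_subset_cball_iff)
    then show "\<exists>d>0. cball z d \<subseteq> UNIV \<and> uniform_limit (cball z d)
        (\<lambda>n z. \<Prod>m<n. weierstrass_factor p (z / c m)) (canonical_product p c) sequentially"
      by (intro exI[of _ 1]) auto
  qed (auto intro!: holomorphic_on_prod holomorphic_weierstrass_factor_quotient)
qed auto

lemma canonical_product_eq_0_iff:
  fixes c :: "nat \<Rightarrow> complex"
  assumes c: "summable (\<lambda>m. 1 / norm (c m) ^ Suc p)"
  shows "canonical_product p c z = 0 \<longleftrightarrow> (\<exists>m. c m \<noteq> 0 \<and> c m = z)"
  using has_prod_eq_0_iff[OF canonical_product_has_prod[OF c], of z]
  by (auto simp: image_iff divide_eq_eq)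

text \<open>
  A value \<open>w \<noteq> 0\<close> taken at \<open>m\<close> gives \<open>w / c m = 1\<close>, and only finitely many of these
  quotients exceed \<open>1/2\<close>.
\<close>

lemma finite_repetitions:
  fixes c :: "nat \<Rightarrow> complex"
  assumes c: "summable (\<lambda>m. 1 / norm (c m) ^ Suc p)"
  shows "finite {m. c m \<noteq> 0 \<and> c m = w}"
proof -
  have "norm w + 1 > 0" by (simp add: add_nonneg_pos)
  from eventually_small_quotients[OF c this]
  have "\<forall>\<^sub>F m in cofinite. \<forall>z\<in>cball 0 (norm w + 1). norm (z / c m) \<le> 1 / 2"
    unfolding cofinite_eq_sequentially .
  then have "\<forall>\<^sub>F m in cofinite. \<not> (c m \<noteq> 0 \<and> c m = w)"
    by eventually_elim (auto dest!: bspec[of _ _ w])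
  then show ?thesis by (simp add: eventually_cofinite)
qed

lemma canonical_product_split:
  fixes c :: "nat \<Rightarrow> complex"
  assumes c: "summable (\<lambda>m. 1 / norm (c m) ^ Suc p)" and F: "finite F"
  shows "canonical_product p c z =
    (\<Prod>m\<in>F. weierstrass_factor p (z / c m)) * canonical_product p (\<lambda>m. if m \<in> F then 0 else c m) z"
proof -
  have c': "summable (\<lambda>m. 1 / norm (if m \<in> F then 0 else c m) ^ Suc p)"
    by (rule summable_comparison_test'[OF c, of 0]) auto
  have "(\<lambda>m. (if m \<in> F then weierstrass_factor p (z / c m) else 1) *
           weierstrass_factor p (z / (if m \<in> F then 0 else c m))) has_prod
        ((\<Prod>m\<in>F. weierstrass_factor p (z / c m)) * canonical_product p (\<lambda>m. if m \<in> F then 0 else c m) z)"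
    by (intro has_prod_mult has_prod_If_finite_set F canonical_product_has_prod c')
  also have "(\<lambda>m. (if m \<in> F then weierstrass_factor p (z / c m) else 1) *
           weierstrass_factor p (z / (if m \<in> F then 0 else c m))) = (\<lambda>m. weierstrass_factor p (z / c m))"
    by auto
  finally show ?thesis
    using canonical_product_has_prod[OF c] has_prod_unique2 by blast
qed

text \<open>
  The finitely many factors with \<open>c m = w\<close> are all equal to \<open>E\<^sub>p(z/w)\<close>, which is \<open>z - w\<close> times a zero-free
  function; the product over the other indices does not vanish at \<open>w\<close>.  This determines the order of
  the zero at \<open>w\<close>.
\<close>

lemma canonical_product_factor_out:
  fixes c :: "nat \<Rightarrow> complex"
  assumes c: "summable (\<lambda>m. 1 / norm (c m) ^ Suc p)"
  obtains g where "g holomorphic_on UNIV" "g w \<noteq> 0"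
    "\<And>z. canonical_product p c z = (z - w) ^ card {m. c m \<noteq> 0 \<and> c m = w} * g z"
proof -
  define F where "F = {m. c m \<noteq> 0 \<and> c m = w}"
  have F: "finite F" unfolding F_def by (rule finite_repetitions[OF c])
  define d where "d = (\<lambda>m. if m \<in> F then 0 else c m)"
  have d: "summable (\<lambda>m. 1 / norm (d m) ^ Suc p)"
    by (rule summable_comparison_test'[OF c, of 0]) (auto simp: d_def)
  \<comment> \<open>for \<open>w = 0\<close> the set \<open>F\<close> is empty, and \<open>e\<close> enters only through \<open>e z ^ 0\<close>\<close>
  define e where "e = (\<lambda>z. (- 1 / w) * exp (\<Sum>k=1..p. (z / w) ^ k / of_nat k))"
  define g where "g = (\<lambda>z. e z ^ card F * canonical_product p d z)"
  have factor: "weierstrass_factor p (z / w) = (z - w) * e z" if "w \<noteq> 0" for z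
    using that by (simp add: weierstrass_factor_def e_def field_simps)
  have w: "w \<noteq> 0" if "F \<noteq> {}"
    using that by (auto simp: F_def)
  show ?thesis
  proof
    show "g holomorphic_on UNIV"
      unfolding g_def e_def divide_inverse
      by (intro holomorphic_intros canonical_product_holomorphic d)
    have "canonical_product p d w \<noteq> 0"
      unfolding canonical_product_eq_0_iff[OF d] by (auto simp: d_def F_def)
    moreover have "e w ^ card F \<noteq> 0"
      using w by (cases "F = {}") (auto simp: e_def)
    ultimately show "g w \<noteq> 0" by (simp add: g_def)
    fix z
    have "(\<Prod>m\<in>F. weierstrass_factor p (z / c m)) = (\<Prod>m\<in>F. (z - w) * e z)"
      using factor by (intro prod.cong) (auto simp: F_def)
    then show "canonical_product p c z = (z - w) ^ card {m. c m \<noteq> 0 \<and> c m = w} * g z"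
      using canonical_product_split[OF c F, of z]
      by (simp add: g_def d_def F_def power_mult_distrib mult_ac)
  qed
qed

section \<open>Logarithmic derivatives of canonical products\<close>

text \<open>
  The left-hand side is the logarithmic derivative of \<open>E\<^sub>p(z/c)\<close> in the form that is visibly of size
  \<open>O(1 / norm c ^ (p + 1))\<close>; the right-hand side separates its pole from a polynomial of degree below \<open>p\<close>,
  which disappears after \<open>p\<close> derivatives.
\<close>

lemma geometric_partial_fraction:
  fixes z c :: complex
  assumes "c \<noteq> 0" "z \<noteq> c"
  shows "(z / c) ^ p / (z - c) = 1 / (z - c) + (\<Sum>k<p. z ^ k / c ^ Suc k)"
proof -
  have "(\<Sum>k<p. z ^ k / c ^ Suc k) = (\<Sum>k<p. (z / c) ^ k) / c"
    by (simp add: sum_divide_distrib power_divide mult_ac)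
  also have "(\<Sum>k<p. (z / c) ^ k) = ((z / c) ^ p - 1) / (z / c - 1)"
    using assms by (intro geometric_sum) auto
  also have "\<dots> / c = ((z / c) ^ p - 1) / (z - c)"
    using assms by (simp add: divide_simps)
  finally show ?thesis by (simp add: diff_divide_distrib)
qed

lemma deriv_weierstrass_factor_quotient:
  assumes "c \<noteq> 0" "z \<noteq> c"
  shows "deriv (\<lambda>z. weierstrass_factor p (z / c)) z / weierstrass_factor p (z / c)
           = 1 / (z - c) + (\<Sum>k<p. z ^ k / c ^ Suc k)"
proof -
  define E where "E = (\<lambda>z::complex. exp (\<Sum>k=1..p. (z / c) ^ k / of_nat k))"
  have S: "((\<lambda>z. \<Sum>k=1..p. (z / c) ^ k / of_nat k) has_field_derivative (\<Sum>k<p. z ^ k / c ^ Suc k)) (at z)"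
  proof -
    have "((\<lambda>z. \<Sum>k=1..p. (z / c) ^ k / of_nat k) has_field_derivative
            (\<Sum>k=1..p. of_nat k * ((z / c) ^ (k - Suc 0) * (1 / c)) / of_nat k)) (at z)"
      using assms by (auto intro!: derivative_eq_intros sum.cong)
    also have "(\<Sum>k=1..p. of_nat k * ((z / c) ^ (k - Suc 0) * (1 / c)) / of_nat k)
             = (\<Sum>k<p. z ^ k / c ^ Suc k)"
    proof (rule sum.reindex_bij_witness[of _ Suc "\<lambda>k. k - 1"])
      fix k assume "k \<in> {1..p}"
      then obtain j where "k = Suc j" by (cases k) auto
      then show "z ^ (k - 1) / c ^ Suc (k - 1) = of_nat k * ((z / c) ^ (k - Suc 0) * (1 / c)) / of_nat k"
        by (simp add: power_divide mult_ac del: of_nat_Suc)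
    qed auto
    finally show ?thesis .
  qed
  have "((\<lambda>z. weierstrass_factor p (z / c)) has_field_derivative
          (- (1 / c) * E z + (1 - z / c) * (E z * (\<Sum>k<p. z ^ k / c ^ Suc k)))) (at z)"
  proof -
    have E: "(E has_field_derivative E z * (\<Sum>k<p. z ^ k / c ^ Suc k)) (at z)"
      unfolding E_def by (rule DERIV_chain2[OF DERIV_exp S])
    have "((\<lambda>z. 1 - z / c) has_field_derivative - (1 / c)) (at z)"
      using assms by (auto intro!: derivative_eq_intros)
    from DERIV_mult[OF this E] show ?thesis
      unfolding weierstrass_factor_def E_def by (simp add: mult_ac add_ac)
  qed
  then have "deriv (\<lambda>z. weierstrass_factor p (z / c)) z =
      - (1 / c) * E z + (1 - z / c) * (E z * (\<Sum>k<p. z ^ k / c ^ Suc k))"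
    by (rule DERIV_imp_deriv)
  moreover have "weierstrass_factor p (z / c) = (1 - z / c) * E z"
    by (simp add: weierstrass_factor_def E_def)
  moreover have "E z \<noteq> 0" "1 - z / c \<noteq> 0" using assms by (auto simp: E_def)
  moreover have quotient: "(x * e + q * (e * s)) / (q * e) = x / q + s"
    if "q \<noteq> 0" "e \<noteq> 0" for x e q s :: complex
    using that by (simp add: field_simps)
  ultimately have "deriv (\<lambda>z. weierstrass_factor p (z / c)) z / weierstrass_factor p (z / c)
      = - (1 / c) / (1 - z / c) + (\<Sum>k<p. z ^ k / c ^ Suc k)"
    by (simp only: quotient)
  also have "- (1 / c) / (1 - z / c) = 1 / (z - c)"
    using assms by (simp add: divide_simps)
  finally show ?thesis .
qed

lemma higher_deriv_poly: "(deriv ^^ n) (poly q) = poly ((pderiv ^^ n) (q :: complex poly))"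
proof (induction n)
  case (Suc n)
  have "deriv (poly r) = poly (pderiv r)" for r :: "complex poly"
    by (rule ext) (rule DERIV_imp_deriv[OF poly_DERIV])
  then show ?case using Suc by simp
qed simp

lemma higher_pderiv_eq_0: "degree q < n \<Longrightarrow> (pderiv ^^ n) (q :: complex poly) = 0"
  by (intro poly_eqI) (simp add: coeff_higher_pderiv coeff_eq_0)

lemma higher_deriv_inverse_linear:
  fixes z c :: complex
  assumes "z \<noteq> c"
  shows "(deriv ^^ n) (\<lambda>z. 1 / (z - c)) z = (-1) ^ n * fact n / (z - c) ^ Suc n"
  using assms
proof (induction n arbitrary: z)
  case (Suc n)
  define K where "K = (-1) ^ n * fact n * (1 :: complex)"
  have "((\<lambda>z. K * inverse (z - c) ^ Suc n) has_field_derivative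
           K * (of_nat (Suc n) * inverse (z - c) ^ n * - (inverse (z - c) * inverse (z - c)))) (at z)"
  proof -
    have "((\<lambda>z. inverse (z - c)) has_field_derivative - (inverse (z - c) * inverse (z - c))) (at z)"
      using Suc.prems by (auto intro!: derivative_eq_intros)
    from DERIV_cmult[OF DERIV_power[OF this, of "Suc n"], of K] show ?thesis
      by (simp add: mult_ac)
  qed
  also have "K * (of_nat (Suc n) * inverse (z - c) ^ n * - (inverse (z - c) * inverse (z - c)))
      = (-1) ^ Suc n * fact (Suc n) * inverse (z - c) ^ Suc (Suc n)"
    by (simp add: K_def mult_ac)
  finally have "((deriv ^^ n) (\<lambda>z. 1 / (z - c)) has_field_derivative
          (-1) ^ Suc n * fact (Suc n) * inverse (z - c) ^ Suc (Suc n)) (at z)"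
    by (rule has_field_derivative_transform_within_open[where S = "-{c}"])
       (use Suc in \<open>auto simp: K_def divide_inverse power_inverse\<close>)
  then have "deriv ((deriv ^^ n) (\<lambda>z. 1 / (z - c))) z
      = (-1) ^ Suc n * fact (Suc n) * inverse (z - c) ^ Suc (Suc n)"
    by (rule DERIV_imp_deriv)
  then show ?case by (simp add: divide_inverse power_inverse)
qed simp

lemma higher_deriv_inverse_linear_plus_poly:
  fixes z c :: complex
  assumes "z \<noteq> c" "degree q < n"
  shows "(deriv ^^ n) (\<lambda>z. 1 / (z - c) + poly q z) z = (-1) ^ n * fact n / (z - c) ^ Suc n"
proof -
  have "(deriv ^^ n) (\<lambda>z. 1 / (z - c) + poly q z) z =
          (deriv ^^ n) (\<lambda>z. 1 / (z - c)) z + (deriv ^^ n) (poly q) z"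
    using assms by (intro higher_deriv_add[where S = "-{c}"]) (auto intro!: holomorphic_intros)
  then show ?thesis
    using assms by (simp add: higher_deriv_inverse_linear higher_deriv_poly higher_pderiv_eq_0)
qed
text \<open>
  Pointwise convergence is the rule for logarithmic derivatives of locally uniform products.  It
  becomes uniform by the M-test: for \<open>norm (z / c m) \<le> 1 / 2\<close> the denominator satisfies
  \<open>norm (z - c m) \<ge> norm (c m) / 2\<close>, so the \<open>m\<close>-th term is at most \<open>2 R ^ p / norm (c m) ^ (p + 1)\<close>.
\<close>

lemma logderiv_canonical_product_uniform_limit:
  fixes c :: "nat \<Rightarrow> complex"
  assumes c: "summable (\<lambda>m. 1 / norm (c m) ^ Suc p)"
    and A: "open A" "A \<subseteq> cball 0 R" "R > 0" "\<And>m. c m \<noteq> 0 \<Longrightarrow> c m \<notin> A"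
  shows "uniform_limit A
     (\<lambda>n z. \<Sum>m<n. if c m = 0 then 0 else 1 / (z - c m) + (\<Sum>k<p. z ^ k / c m ^ Suc k))
     (\<lambda>z. deriv (canonical_product p c) z / canonical_product p c z) sequentially"
    (is "uniform_limit A (\<lambda>n z. \<Sum>m<n. ?T m z) ?D sequentially")
proof -
  have sums: "(\<lambda>m. ?T m z) sums ?D z" if z: "z \<in> A" for z
  proof -
    have "(\<lambda>m. deriv (\<lambda>z. weierstrass_factor p (z / c m)) z / weierstrass_factor p (z / c m))
            sums ?D z"
    proof (rule logderiv_prodinf_complex_uniform_limit[OF _ holomorphic_weierstrass_factor_quotient])
      show "uniform_limit A (\<lambda>n z. \<Prod>m<n. weierstrass_factor p (z / c m)) (canonical_product p c) sequentially"
        by (rule uniform_limit_on_subset[OF canonical_product_uniform_limit[OF c A(3)] A(2)])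
      show "canonical_product p c z \<noteq> 0"
        using A(4) z by (auto simp: canonical_product_eq_0_iff[OF c])
    qed (use A z in auto)
    also have "(\<lambda>m. deriv (\<lambda>z. weierstrass_factor p (z / c m)) z / weierstrass_factor p (z / c m)) =
               (\<lambda>m. ?T m z)"
    proof
      fix m
      show "deriv (\<lambda>z. weierstrass_factor p (z / c m)) z / weierstrass_factor p (z / c m) = ?T m z"
      proof (cases "c m = 0")
        case False
        moreover have "z \<noteq> c m" using A(4) z False by auto
        ultimately show ?thesis by (simp add: deriv_weierstrass_factor_quotient del: power_Suc)
      qed simp
    qed
    finally show ?thesis .
  qed
  have "uniform_limit A (\<lambda>n z. \<Sum>m<n. ?T m z) (\<lambda>z. \<Sum>m. ?T m z) sequentially"
  proof (rule Weierstrass_m_test_ev)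
    show "\<forall>\<^sub>F m in sequentially. \<forall>z\<in>A. norm (?T m z) \<le> 2 * R ^ p * (1 / norm (c m) ^ Suc p)"
      using eventually_small_quotients[OF c A(3)]
    proof eventually_elim
      case (elim m)
      show ?case
      proof
        fix z assume z: "z \<in> A"
        show "norm (?T m z) \<le> 2 * R ^ p * (1 / norm (c m) ^ Suc p)"
        proof (cases "c m = 0")
          case False
          then have "z \<noteq> c m" using A(4) z by auto
          then have "?T m z = (z / c m) ^ p / (z - c m)"
            using False by (simp add: geometric_partial_fraction)
          then have *: "norm (?T m z) = (norm z / norm (c m)) ^ p / norm (z - c m)"
            by (simp only: norm_divide norm_power)
          have zR: "norm z \<le> R" using z A(2) by auto
          have "norm (z / c m) \<le> 1 / 2" using elim z A(2) by blast
          then have "norm z \<le> norm (c m) / 2" using False by (simp add: norm_divide field_simps)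
          moreover have "norm (c m) \<le> norm z + norm (z - c m)"
            using norm_triangle_sub[of "c m" z] by (simp add: norm_minus_commute)
          ultimately have "norm (c m) / 2 \<le> norm (z - c m)" by simp
          then have "(norm z / norm (c m)) ^ p / norm (z - c m) \<le> (R / norm (c m)) ^ p / (norm (c m) / 2)"
            using False zR A(3) by (intro frac_le power_mono divide_right_mono) auto
          also have "\<dots> = 2 * R ^ p * (1 / norm (c m) ^ Suc p)"
            by (simp add: power_divide mult_ac)
          finally show ?thesis using * by simp
        qed (use A(3) in simp)
      qed
    qed
  qed (intro summable_mult c)
  then show ?thesis
    by (rule uniform_limit_cong'[THEN iffD1, rotated -1]) (use sums in \<open>auto simp: sums_iff\<close>)
qed

lemma poly_of_geometric_tail:
  obtains q :: "complex poly" where "\<And>z. (\<Sum>k<p. z ^ k / c ^ Suc k) = poly q z" "q = 0 \<or> degree q < p"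
proof
  define q where "q = (\<Sum>k<p. monom (1 / c ^ Suc k) k)"
  show "(\<Sum>k<p. z ^ k / c ^ Suc k) = poly q z" for z
    by (simp add: q_def poly_sum poly_monom)
  show "q = 0 \<or> degree q < p"
  proof (cases "p = 0")
    case False
    have "degree q \<le> p - 1"
      unfolding q_def by (rule degree_sum_le) (auto intro!: order.trans[OF degree_monom_le])
    then show ?thesis using False by auto
  qed (simp add: q_def)
qed

text \<open>
  Locally uniform convergence of holomorphic functions passes to all derivatives, and the \<open>p\<close>-th
  derivative of each term retains only the pole.
\<close>

lemma higher_deriv_logderiv_canonical_product:
  fixes c :: "nat \<Rightarrow> complex"
  assumes c: "summable (\<lambda>m. 1 / norm (c m) ^ Suc p)" and p: "p \<ge> 1"
    and A: "open A" "\<And>m. c m \<noteq> 0 \<Longrightarrow> c m \<notin> A" "z \<in> A"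
  shows "(\<lambda>m. if c m = 0 then 0 else (-1) ^ p * fact p / (z - c m) ^ Suc p) sums
     (deriv ^^ p) (\<lambda>z. deriv (canonical_product p c) z / canonical_product p c z) z"
proof -
  let ?T = "\<lambda>m z. if c m = 0 then 0 else 1 / (z - c m) + (\<Sum>k<p. z ^ k / c m ^ Suc k)"
  \<comment> \<open>the M-test needs a bounded domain\<close>
  define B where "B = A \<inter> ball 0 (norm z + 1)"
  have B: "open B" "z \<in> B" "\<And>m. c m \<noteq> 0 \<Longrightarrow> c m \<notin> B" "B \<subseteq> cball 0 (norm z + 1)"
    using A by (auto simp: B_def)
  have hol: "?T m holomorphic_on B" for m
    using B(3)[of m] by (cases "c m = 0") (auto intro!: holomorphic_intros)
  have lim: "uniform_limit B (\<lambda>n z. \<Sum>m<n. ?T m z)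
     (\<lambda>z. deriv (canonical_product p c) z / canonical_product p c z) sequentially"
    by (rule logderiv_canonical_product_uniform_limit[OF c B(1,4) _ B(3)]) (simp add: add_nonneg_pos)
  have "(\<lambda>n. (deriv ^^ p) (\<lambda>z. \<Sum>m<n. ?T m z) z) \<longlonglongrightarrow>
     (deriv ^^ p) (\<lambda>z. deriv (canonical_product p c) z / canonical_product p c z) z"
    by (rule higher_deriv_complex_uniform_limit[OF lim _ _ B(1,2)])
       (intro always_eventually allI holomorphic_on_sum hol, simp)
  also have "(\<lambda>n. (deriv ^^ p) (\<lambda>z. \<Sum>m<n. ?T m z) z) = (\<lambda>n. \<Sum>m<n. (deriv ^^ p) (?T m) z)"
  proof
    fix n
    show "(deriv ^^ p) (\<lambda>z. \<Sum>m<n. ?T m z) z = (\<Sum>m<n. (deriv ^^ p) (?T m) z)"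
    proof (induction n)
      case (Suc n)
      have "(deriv ^^ p) (\<lambda>z. (\<Sum>m<n. ?T m z) + ?T n z) z =
            (deriv ^^ p) (\<lambda>z. \<Sum>m<n. ?T m z) z + (deriv ^^ p) (?T n) z"
        by (rule higher_deriv_add[OF holomorphic_on_sum[OF hol] hol B(1,2)])
      then show ?case using Suc.IH by simp
    qed (simp add: higher_deriv_const)
  qed
  also have "(\<lambda>n. \<Sum>m<n. (deriv ^^ p) (?T m) z) =
     (\<lambda>n. \<Sum>m<n. if c m = 0 then 0 else (-1) ^ p * fact p / (z - c m) ^ Suc p)"
  proof (intro ext sum.cong refl)
    fix m
    show "(deriv ^^ p) (?T m) z = (if c m = 0 then 0 else (-1) ^ p * fact p / (z - c m) ^ Suc p)"
    proof (cases "c m = 0")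
      case True
      then show ?thesis using p by (simp add: higher_deriv_const)
    next
      case False
      obtain q where q: "\<And>z. (\<Sum>k<p. z ^ k / c m ^ Suc k) = poly q z" "q = 0 \<or> degree q < p"
        using poly_of_geometric_tail by blast
      have "z \<noteq> c m" using B False by auto
      moreover have "degree q < p" using q(2) p by auto
      ultimately show ?thesis
        using False by (simp add: q(1) higher_deriv_inverse_linear_plus_poly del: power_Suc)
    qed
  qed
  finally show ?thesis by (simp add: sums_def)
qed

section \<open>The logarithm of a function in the class\<close>

lemma bij_betw_equal_fibres:
  assumes "\<And>w. finite {x\<in>A. u x = w}" "\<And>w. finite {y\<in>B. v y = w}"
    and "\<And>w. card {x\<in>A. u x = w} = card {y\<in>B. v y = w}"
  obtains \<pi> where "bij_betw \<pi> A B" "\<And>x. x \<in> A \<Longrightarrow> v (\<pi> x) = u x"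
proof -
  have "\<exists>h. bij_betw h {x\<in>A. u x = w} {y\<in>B. v y = w}" for w
    by (rule finite_same_card_bij[OF assms(1,2,3)])
  then obtain h where h: "\<And>w. bij_betw (h w) {x\<in>A. u x = w} {y\<in>B. v y = w}"
    by metis
  define \<pi> where "\<pi> = (\<lambda>x. h (u x) x)"
  have mem: "\<pi> x \<in> B" "v (\<pi> x) = u x" if "x \<in> A" for x
    using bij_betwE[OF h[of "u x"]] that by (auto simp: \<pi>_def)
  show ?thesis
  proof
    show "bij_betw \<pi> A B"
    proof (rule bij_betwI')
      fix x y assume xy: "x \<in> A" "y \<in> A"
      show "\<pi> x = \<pi> y \<longleftrightarrow> x = y"
      proof
        assume eq: "\<pi> x = \<pi> y"
        then have "u x = u y" using mem xy by metis
        then show "x = y"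
          using eq xy bij_betw_imp_inj_on[OF h[of "u x"]] by (auto simp: \<pi>_def inj_on_def)
      qed simp
    next
      fix y assume "y \<in> B"
      then have "y \<in> h (v y) ` {x\<in>A. u x = v y}"
        using bij_betw_imp_surj_on[OF h[of "v y"]] by auto
      then show "\<exists>x\<in>A. y = \<pi> x" unfolding \<pi>_def by force
    qed (use mem in auto)
  qed (use mem in auto)
qed

text \<open>
  The zeros of the factorization lie on the non-positive real axis because they are zeros of \<open>f\<close>.
  Indices outside the index set are absorbed by putting \<open>c m = 0\<close>.
\<close>

lemma class_E_factorization:
  assumes f: "f \<in> class_E p"
  obtains r :: nat and Q :: "complex poly" and c :: "nat \<Rightarrow> complex" where
    "degree Q \<le> p" "summable (\<lambda>m. 1 / norm (c m) ^ Suc p)" "\<And>m. c m \<in> \<real>\<^sub>\<le>\<^sub>0"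
    "\<And>z. f z = z ^ r * exp (poly Q z) * canonical_product p c z"
proof -
  from f obtain r Q N c where Q: "degree Q \<le> p"
    and nz: "\<forall>m\<in>index_set N. c m \<noteq> 0"
    and sm: "(\<lambda>m. 1 / norm (c m) ^ (p + 1)) summable_on index_set N"
    and fz: "\<And>z. f z = z ^ r * exp (poly Q z) *
               (\<Prod>m. if m \<in> index_set N then weierstrass_factor p (z / c m) else 1)"
    by (auto simp: class_E_def has_genus_def hadamard_rep_def)
  define d where "d = (\<lambda>m. if m \<in> index_set N then c m else 0)"
  have "(\<lambda>m. 1 / norm (d m) ^ Suc p) summable_on UNIV"
    using sm by (rule summable_on_cong_neutral[THEN iffD1, rotated -1]) (auto simp: d_def)
  then have d: "summable (\<lambda>m. 1 / norm (d m) ^ Suc p)"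
    by (rule summable_on_imp_summable)
  have fd: "f z = z ^ r * exp (poly Q z) * canonical_product p d z" for z
    unfolding fz canonical_product_def by (intro arg_cong2[where f = "(*)"] prodinf_cong refl) (auto simp: d_def)
  have "d m \<in> \<real>\<^sub>\<le>\<^sub>0" for m
  proof (cases "d m = 0")
    case False
    then have "canonical_product p d (d m) = 0"
      by (auto simp: canonical_product_eq_0_iff[OF d])
    then have "f (d m) = 0" by (simp add: fd)
    then show ?thesis using f by (auto simp: class_E_def)
  qed auto
  then show ?thesis using that[OF Q d _ fd] by blast
qed

lemma zorder_eq_count:
  fixes c :: "nat \<Rightarrow> complex"
  assumes c: "summable (\<lambda>m. 1 / norm (c m) ^ Suc p)"
    and f: "\<And>z. f z = z ^ r * exp (poly Q z) * canonical_product p c z"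
  shows "(if f w = 0 then zorder f w else 0) = int ((if w = 0 then r else 0) + card {m. c m \<noteq> 0 \<and> c m = w})"
proof -
  define k where "k = card {m. c m \<noteq> 0 \<and> c m = w}"
  define j where "j = (if w = 0 then r else 0)"
  obtain g where g: "g holomorphic_on UNIV" "g w \<noteq> 0" "\<And>z. canonical_product p c z = (z - w) ^ k * g z"
    using canonical_product_factor_out[OF c, where w = w] unfolding k_def by blast
  define u where "u = (\<lambda>z. z ^ (r - j) * exp (poly Q z) * g z)"
  have u: "u holomorphic_on UNIV" "u w \<noteq> 0"
    using g(1,2) by (auto simp: u_def j_def intro!: holomorphic_intros)
  have fu: "f z = u z * (z - w) ^ (j + k)" for z
  proof -
    have "z ^ r = z ^ (r - j) * (z - w) ^ j" by (simp add: j_def)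
    then show ?thesis unfolding f g(3) u_def by (simp only: power_add mult_ac)
  qed
  have "zorder f w = int (j + k)"
    by (rule zorder_eqI[OF open_UNIV _ u]) (simp_all only: fu power_int_of_nat UNIV_I)
  moreover have "j + k = 0" if "f w \<noteq> 0"
    using that by (auto simp: fu)
  ultimately show ?thesis by (auto simp: j_def k_def)
qed

text \<open>
  The zeros of the factorization, \<open>r\<close> copies of \<open>0\<close> together with the \<open>c m \<noteq> 0\<close>, and the numbers
  \<open>- lam m\<close> take every value equally often, namely as often as the order of the zero of \<open>f\<close> prescribes.
  Matching the fibres yields a bijection of the index sets, along which an absolutely convergent sum
  may be transported.
\<close>

lemma reindex_zeros_has_sum:
  fixes c :: "nat \<Rightarrow> complex" and G :: "complex \<Rightarrow> complex"
  assumes c: "summable (\<lambda>m. 1 / norm (c m) ^ Suc p)"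
    and f: "\<And>z. f z = z ^ r * exp (poly Q z) * canonical_product p c z"
    and lam: "lists_zeros f N lam"
    and S: "(\<lambda>m. if c m = 0 then 0 else G (c m)) sums S"
      "summable (\<lambda>m. norm (if c m = 0 then 0 else G (c m)))"
  shows "((\<lambda>m. G (- of_real (lam m))) has_sum of_nat r * G 0 + S) (index_set N)"
proof -
  \<comment> \<open>the left summand indexes the \<open>r\<close> zeros at the origin, the right one the zeros \<open>c m\<close>\<close>
  define B where "B = Inl ` {..<r} \<union> Inr ` {m. c m \<noteq> 0}"
  define v where "v = (\<lambda>x::nat + nat. case x of Inl _ \<Rightarrow> 0 | Inr m \<Rightarrow> c m)"
  have fib: "{y\<in>B. v y = w} = Inl ` (if w = 0 then {..<r} else {}) \<union> Inr ` {m. c m \<noteq> 0 \<and> c m = w}" for w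
    by (auto simp: B_def v_def)
  have finB: "finite {y\<in>B. v y = w}" for w
    unfolding fib using finite_repetitions[OF c] by auto
  have cardB: "card {y\<in>B. v y = w} = (if w = 0 then r else 0) + card {m. c m \<noteq> 0 \<and> c m = w}" for w
    unfolding fib by (subst card_Un_disjoint) (use finite_repetitions[OF c] in \<open>auto simp: card_image\<close>)
  have cards: "card {m\<in>index_set N. - of_real (lam m) = w} = card {y\<in>B. v y = w}" for w
  proof -
    have "int (card {m\<in>index_set N. - of_real (lam m) = w}) = (if f w = 0 then zorder f w else 0)"
      using lam by (simp add: lists_zeros_def)
    also have "\<dots> = int (card {y\<in>B. v y = w})"
      unfolding cardB by (rule zorder_eq_count[OF c f])
    finally show ?thesis by simp
  qed
  obtain \<pi> where \<pi>: "bij_betw \<pi> (index_set N) B" "\<And>m. m \<in> index_set N \<Longrightarrow> v (\<pi> m) = - of_real (lam m)"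
    by (rule bij_betw_equal_fibres[of "index_set N" "\<lambda>m. - of_real (lam m)" B v])
       (use lam finB cards in \<open>auto simp: lists_zeros_def\<close>)
  have "((\<lambda>y. G (v y)) has_sum (\<Sum>y\<in>Inl ` {..<r}. G (v y))) (Inl ` {..<r})"
    by (rule has_sum_finite) simp
  then have L: "((\<lambda>y. G (v y)) has_sum of_nat r * G 0) (Inl ` {..<r})"
    by (simp add: sum.reindex v_def)
  have "((\<lambda>m. if c m = 0 then 0 else G (c m)) has_sum S) UNIV"
    using S by (intro norm_summable_imp_has_sum)
  then have "((\<lambda>m. G (c m)) has_sum S) {m. c m \<noteq> 0}"
    by (rule has_sum_cong_neutral[THEN iffD1, rotated -1]) auto
  then have R: "((\<lambda>y. G (v y)) has_sum S) (Inr ` {m. c m \<noteq> 0})"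
    by (subst has_sum_reindex) (auto simp: o_def v_def)
  have "((\<lambda>y. G (v y)) has_sum of_nat r * G 0 + S) B"
    unfolding B_def by (rule has_sum_Un_disjoint[OF L R]) auto
  then have "((\<lambda>m. G (v (\<pi> m))) has_sum of_nat r * G 0 + S) (index_set N)"
    by (subst has_sum_reindex_bij_betw[OF \<pi>(1)])
  then show ?thesis
    by (rule has_sum_cong[THEN iffD1, rotated]) (simp add: \<pi>(2))
qed

text \<open>
  Differentiate \<open>exp (log f) = f\<close>.
\<close>

lemma deriv_log_branch:
  assumes f: "f \<in> class_E p" and z: "z \<in> - \<real>\<^sub>\<le>\<^sub>0"
  shows "deriv (log_branch f) z = deriv f z / f z"
proof -
  have L: "log_branch f holomorphic_on - \<real>\<^sub>\<le>\<^sub>0" "\<And>z. z \<in> - \<real>\<^sub>\<le>\<^sub>0 \<Longrightarrow> exp (log_branch f z) = f z"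
    using is_log_branch_log_branch[OF f] by (auto simp: is_log_branch_def)
  have op: "open (- \<real>\<^sub>\<le>\<^sub>0 :: complex set)" by (intro open_Compl closed_nonpos_Reals_complex)
  have "(log_branch f has_field_derivative deriv (log_branch f) z) (at z)"
    by (rule holomorphic_derivI[OF L(1) op z])
  from DERIV_chain2[OF DERIV_exp this]
  have "((\<lambda>w. exp (log_branch f w)) has_field_derivative f z * deriv (log_branch f) z) (at z)"
    unfolding L(2)[OF z] .
  then have "(f has_field_derivative f z * deriv (log_branch f) z) (at z)"
    by (rule has_field_derivative_transform_within_open[OF _ op z]) (rule L(2))
  then have "deriv f z = f z * deriv (log_branch f) z" by (rule DERIV_imp_deriv)
  moreover have "f z \<noteq> 0" using L(2)[OF z] by (metis exp_not_eq_zero)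
  ultimately show ?thesis by simp
qed

text \<open>
  In \<open>(log f)' = r / z + Q' + P' / P\<close>, with \<open>P\<close> the canonical product, the polynomial \<open>Q'\<close> has degree at
  most \<open>p - 1\<close>, so \<open>p\<close> further derivatives leave only the contributions of the zeros.  In the right
  half-plane \<open>norm (z - c m) \<ge> norm (c m)\<close>, since all \<open>c m\<close> are non-positive; this makes the resulting series
  absolutely convergent.
\<close>

lemma higher_deriv_log_branch:
  assumes f: "f \<in> class_E p" and p: "p \<ge> 1" and lam: "lists_zeros f N lam" and z: "Re z > 0"
  shows "((\<lambda>m. (-1) ^ p * fact p / (z + of_real (lam m)) ^ Suc p) has_sum
            (deriv ^^ Suc p) (log_branch f) z) (index_set N)"
proof -
  obtain r Q c where Q: "degree Q \<le> p" and c: "summable (\<lambda>m. 1 / norm (c m) ^ Suc p)"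
    and neg: "\<And>m. c m \<in> \<real>\<^sub>\<le>\<^sub>0"
    and fz: "\<And>z. f z = z ^ r * exp (poly Q z) * canonical_product p c z"
    by (rule class_E_factorization[OF f]) (rule that)
  define P where "P = canonical_product p c"
  define A where "A = {z::complex. Re z > 0}"
  have A: "open A" "z \<in> A" using z by (auto simp: A_def open_halfspace_Re_gt)
  have cA: "c m \<notin> A" for m using neg[of m] by (auto simp: A_def complex_nonpos_Reals_iff)
  have slit: "w \<in> - \<real>\<^sub>\<le>\<^sub>0" if "w \<in> A" for w using that by (auto simp: A_def complex_nonpos_Reals_iff)
  have P0: "P w \<noteq> 0" if "w \<in> A" for w
    using that cA by (auto simp: P_def canonical_product_eq_0_iff[OF c])
  have Phol: "P holomorphic_on B" for B
    unfolding P_def by (rule canonical_product_holomorphic[OF c])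
  have logderiv: "deriv (log_branch f) w = of_nat r * (1 / (w - 0)) + poly (pderiv Q) w + deriv P w / P w"
    if w: "w \<in> A" for w
  proof -
    have w0: "w \<noteq> 0" using w by (auto simp: A_def)
    have P': "(P has_field_derivative deriv P w) (at w)"
      by (rule holomorphic_derivI[OF Phol[of UNIV]]) auto
    have "((\<lambda>w. w ^ r * exp (poly Q w) * P w) has_field_derivative
       (of_nat r * w ^ (r - 1) * exp (poly Q w) + w ^ r * (exp (poly Q w) * poly (pderiv Q) w)) * P w
        + w ^ r * exp (poly Q w) * deriv P w) (at w)"
      by (auto intro!: derivative_eq_intros P' poly_DERIV)
    then have "(f has_field_derivative
       (of_nat r * w ^ (r - 1) * exp (poly Q w) + w ^ r * (exp (poly Q w) * poly (pderiv Q) w)) * P w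
        + w ^ r * exp (poly Q w) * deriv P w) (at w)"
      unfolding P_def fz[abs_def] .
    then have "deriv f w = (of_nat r * w ^ (r - 1) * exp (poly Q w) + w ^ r * (exp (poly Q w) * poly (pderiv Q) w)) * P w
        + w ^ r * exp (poly Q w) * deriv P w"
      by (rule DERIV_imp_deriv)
    moreover have "of_nat r * w ^ (r - 1) = of_nat r * w ^ r / w"
      using w0 by (cases r) auto
    ultimately have "deriv f w / f w = of_nat r * (1 / (w - 0)) + poly (pderiv Q) w + deriv P w / P w"
      using w0 P0[OF w] by (simp add: fz P_def[symmetric] field_simps)
    then show ?thesis using deriv_log_branch[OF f slit[OF w]] by simp
  qed
  define D where "D = (deriv ^^ p) (\<lambda>w. deriv P w / P w) z"
  \<comment> \<open>the contribution of the zeros away from the origin; \<open>r / z\<close> supplies the one of the origin\<close>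
  have D: "(\<lambda>m. if c m = 0 then 0 else (-1) ^ p * fact p / (z - c m) ^ Suc p) sums D"
    unfolding D_def P_def by (rule higher_deriv_logderiv_canonical_product[OF c p A(1) _ A(2)]) (use cA in auto)
  have "(deriv ^^ Suc p) (log_branch f) z = (deriv ^^ p) (deriv (log_branch f)) z"
    by (simp only: funpow_Suc_right o_apply)
  also have "\<dots> = (deriv ^^ p) (\<lambda>w. of_nat r * (1 / (w - 0)) + poly (pderiv Q) w + deriv P w / P w) z"
  proof (rule higher_deriv_cong_ev)
    show "\<forall>\<^sub>F w in nhds z. deriv (log_branch f) w = of_nat r * (1 / (w - 0)) + poly (pderiv Q) w + deriv P w / P w"
      using eventually_nhds_in_open[OF A] by eventually_elim (rule logderiv)
  qed simp
  also have "\<dots> = (deriv ^^ p) (\<lambda>w. of_nat r * (1 / (w - 0))) z + (deriv ^^ p) (poly (pderiv Q)) z + D"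
  proof -
    have h: "(\<lambda>w. of_nat r * (1 / (w - 0))) holomorphic_on A" "poly (pderiv Q) holomorphic_on A"
      "(\<lambda>w. deriv P w / P w) holomorphic_on A"
      using P0 by (auto intro!: holomorphic_intros Phol holomorphic_deriv A(1)) (auto simp: A_def)
    show ?thesis unfolding D_def
      by (subst higher_deriv_add[OF _ h(3) A], intro holomorphic_on_add h,
          subst higher_deriv_add[OF h(1,2) A]) (rule refl)
  qed
  also have "(deriv ^^ p) (\<lambda>w. of_nat r * (1 / (w - 0))) z = of_nat r * ((-1) ^ p * fact p / (z - 0) ^ Suc p)"
  proof -
    have "(\<lambda>w. 1 / (w - 0)) holomorphic_on A" by (auto intro!: holomorphic_intros simp: A_def)
    from higher_deriv_cmult[OF this A(2,1)]
    have "(deriv ^^ p) (\<lambda>w. of_nat r * (1 / (w - 0))) z = of_nat r * (deriv ^^ p) (\<lambda>w. 1 / (w - 0)) z" .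
    moreover have "z \<noteq> 0" using z by auto
    ultimately show ?thesis by (simp only: higher_deriv_inverse_linear[OF \<open>z \<noteq> 0\<close>])
  qed
  also have "(deriv ^^ p) (poly (pderiv Q)) z = 0"
    using Q p by (simp add: higher_deriv_poly higher_pderiv_eq_0 degree_pderiv)
  finally have eq: "(deriv ^^ Suc p) (log_branch f) z = of_nat r * ((-1) ^ p * fact p / (z - 0) ^ Suc p) + D"
    by simp
  have "((\<lambda>m. (-1) ^ p * fact p / (z - (- of_real (lam m))) ^ Suc p) has_sum
           of_nat r * ((-1) ^ p * fact p / (z - 0) ^ Suc p) + D) (index_set N)"
  proof (rule reindex_zeros_has_sum[OF c fz lam D])
    show "summable (\<lambda>m. norm (if c m = 0 then 0 else (-1) ^ p * fact p / (z - c m) ^ Suc p))"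
    proof (rule summable_comparison_test'[OF summable_mult[OF c, of "fact p"], of 0])
      fix m
      show "norm (norm (if c m = 0 then 0 else (-1) ^ p * fact p / (z - c m) ^ Suc p))
              \<le> fact p * (1 / norm (c m) ^ Suc p)"
      proof (cases "c m = 0")
        case False
        obtain x where x: "c m = of_real x" "x \<le> 0" using neg[of m] by (auto simp: nonpos_Reals_def)
        have "norm (c m) \<le> Re (z - c m)" using x z by simp
        also have "\<dots> \<le> norm (z - c m)" by (rule complex_Re_le_cmod)
        finally have "norm (c m) ^ Suc p \<le> norm (z - c m) ^ Suc p" by (intro power_mono) auto
        then have "fact p / norm (z - c m) ^ Suc p \<le> fact p / norm (c m) ^ Suc p"
          using False by (intro divide_left_mono) (auto intro!: mult_pos_pos zero_less_power
              simp del: power_Suc order.strict_trans2[of 0 "norm (c m)"])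
        then show ?thesis using False by (simp add: norm_divide norm_mult norm_power)
      qed simp
    qed
  qed
  then show ?thesis unfolding eq by simp
qed

section \<open>The Peano kernel of the difference functional\<close>

lemma rho_alt:
  "rho l n a b t = (\<Sum>k=1..n. if a k \<le> t then (t - a k) ^ l else 0) - (\<Sum>k=1..n. if b k \<le> t then (t - b k) ^ l else 0)"
  unfolding rho_def indicator_def by (intro arg_cong2[where f = minus] sum.cong) auto

text \<open>
  The condition \<open>l \<ge> 1\<close> removes the jump at \<open>t = a\<close>: it makes \<open>rho\<close> continuous.
\<close>

lemma truncated_power_eq_max:
  fixes a t :: real
  assumes "l \<ge> 1"
  shows "(if a \<le> t then (t - a) ^ l else 0) = max 0 (t - a) ^ l"
  using assms by (auto simp: max_def)

lemma continuous_on_rho: "l \<ge> 1 \<Longrightarrow> continuous_on S (rho l n a b)"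
  unfolding rho_alt[abs_def] truncated_power_eq_max by (intro continuous_intros)

lemma rho_eq_0_left:
  assumes "l \<ge> 1" "\<forall>k\<in>{1..n}. 0 \<le> a k" "\<forall>k\<in>{1..n}. 0 \<le> b k" "t \<le> 0"
  shows "rho l n a b t = 0"
proof -
  have z: "(if x \<le> t then (t - x) ^ l else 0) = 0" if "0 \<le> x" for x :: real
    using that assms by auto
  have "(\<Sum>k=1..n. if a k \<le> t then (t - a k) ^ l else 0) = 0"
       "(\<Sum>k=1..n. if b k \<le> t then (t - b k) ^ l else 0) = 0"
    by (intro sum.neutral ballI z; use assms in blast)+
  then show ?thesis unfolding rho_alt by simp
qed

text \<open>
  Equality of the power sums up to degree \<open>l\<close> is invariant under translation, by the binomial
  theorem.
\<close>

lemma sum_power_diff_cancel: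
  fixes a b :: "nat \<Rightarrow> real"
  assumes "\<forall>j\<le>l. (\<Sum>k=1..n. a k ^ j) = (\<Sum>k=1..n. b k ^ j)" "i \<le> l"
  shows "(\<Sum>k=1..n. (a k - t) ^ i) = (\<Sum>k=1..n. (b k - t) ^ i)"
proof -
  have *: "(\<Sum>k=1..n. (x k - t) ^ i) = (\<Sum>j\<le>i. real (i choose j) * (- t) ^ (i - j) * (\<Sum>k=1..n. x k ^ j))" for x
  proof -
    have "(\<Sum>k=1..n. (x k - t) ^ i) = (\<Sum>k=1..n. \<Sum>j\<le>i. real (i choose j) * (- t) ^ (i - j) * x k ^ j)"
      using binomial_ring[of "x _" "- t" i] by (simp add: mult_ac)
    also have "\<dots> = (\<Sum>j\<le>i. \<Sum>k=1..n. real (i choose j) * (- t) ^ (i - j) * x k ^ j)"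
      by (rule sum.swap)
    finally show ?thesis by (simp add: sum_distrib_left)
  qed
  show ?thesis unfolding * using assms by (intro sum.cong) auto
qed

text \<open>
  Since \<open>(a - t) ^ l\<close> is the sum of its truncation to \<open>t \<le> a\<close> and \<open>(-1) ^ l\<close> times the truncated power
  \<open>(t - a) ^ l\<close>, and the full powers cancel by translation invariance of the power sum identities, \<open>rho\<close> is
  also built from truncations on the other side.  This is why \<open>rho\<close> vanishes beyond all nodes, and why
  it arises from Taylor's formula expanded at \<open>0\<close>.
\<close>

lemma rho_reflected:
  assumes "l \<ge> 1" and pow: "\<forall>j\<le>l. (\<Sum>k=1..n. a k ^ j) = (\<Sum>k=1..n. b k ^ j)"
  shows "(\<Sum>k=1..n. if t \<le> a k then (a k - t) ^ l else 0) - (\<Sum>k=1..n. if t \<le> b k then (b k - t) ^ l else 0)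
          = (-1) ^ (l + 1) * rho l n a b t"
proof -
  have *: "(\<Sum>k=1..n. if t \<le> x k then (x k - t) ^ l else 0) =
      (\<Sum>k=1..n. (x k - t) ^ l) - (-1) ^ l * (\<Sum>k=1..n. if x k \<le> t then (t - x k) ^ l else 0)" for x :: "nat \<Rightarrow> real"
  proof -
    have "(if t \<le> y then (y - t) ^ l else 0) = (y - t) ^ l - (-1) ^ l * (if y \<le> t then (t - y) ^ l else 0)" for y
      using \<open>l \<ge> 1\<close> power_mult_distrib[of "-1" "t - y" l] by auto
    then show ?thesis by (simp add: sum_subtractf sum_distrib_left)
  qed
  show ?thesis
    unfolding * rho_alt sum_power_diff_cancel[OF pow order_refl] by (simp add: algebra_simps)
qed

lemma rho_eq_0_right:
  assumes "l \<ge> 1" and pow: "\<forall>j\<le>l. (\<Sum>k=1..n. a k ^ j) = (\<Sum>k=1..n. b k ^ j)"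
    and M: "\<forall>k\<in>{1..n}. a k \<le> M" "\<forall>k\<in>{1..n}. b k \<le> M" and "t \<ge> M"
  shows "rho l n a b t = 0"
proof -
  have z: "(if t \<le> x then (x - t) ^ l else 0) = 0" if "x \<le> M" for x :: real
    using that assms by auto
  have "(\<Sum>k=1..n. if t \<le> a k then (a k - t) ^ l else 0) = 0"
       "(\<Sum>k=1..n. if t \<le> b k then (b k - t) ^ l else 0) = 0"
    by (intro sum.neutral ballI z; use assms in blast)+
  then show ?thesis using rho_reflected[OF \<open>l \<ge> 1\<close> pow, of t] by simp
qed

text \<open>
  Expand \<open>F 0\<close> at \<open>0\<close> by Taylor's formula with integral remainder.  The Taylor polynomials cancel
  because of the power sums, and the remainders, extended from \<open>{0..x}\<close> to \<open>{0..M}\<close> by truncating the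
  kernel, combine to the reflected form of \<open>rho\<close>.
\<close>

lemma peano_kernel:
  fixes F :: "nat \<Rightarrow> real \<Rightarrow> complex"
  assumes l: "l \<ge> 1" and pow: "\<forall>j\<le>l. (\<Sum>k=1..n. a k ^ j) = (\<Sum>k=1..n. b k ^ j)"
    and a: "\<forall>k\<in>{1..n}. 0 \<le> a k \<and> a k \<le> M" and b: "\<forall>k\<in>{1..n}. 0 \<le> b k \<and> b k \<le> M"
    and F: "\<And>j t. j \<le> l \<Longrightarrow> 0 \<le> t \<Longrightarrow> (F j has_vector_derivative F (Suc j) t) (at t)"
    and cont: "continuous_on {0..M} (F (Suc l))"
  shows "(LINT t:{0..M}|lborel. rho l n a b t *\<^sub>R F (Suc l) t) =
           (-1) ^ (l + 1) * fact l * ((\<Sum>k=1..n. F 0 (a k)) - (\<Sum>k=1..n. F 0 (b k)))"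
proof -
  define K where "K = (\<lambda>x t. if t \<le> x then (x - t) ^ l else (0::real))"
  define T where "T = (\<lambda>x. F 0 x - (\<Sum>i\<le>l. (x ^ i / fact i) *\<^sub>R F i 0))"
  have one: "((\<lambda>t. K x t *\<^sub>R F (Suc l) t) has_integral fact l * T x) {0..M}" if x: "0 \<le> x" "x \<le> M" for x
  proof -
    have "((\<lambda>t. ((x - t) ^ l / fact l) *\<^sub>R F (Suc l) t) has_integral T x) {0..x}"
      using Taylor_has_integral[of "Suc l" F "F 0" 0 x] F x
      by (simp add: T_def lessThan_Suc_atMost has_vector_derivative_at_within)
    from has_integral_mult_right[OF this, of "fact l"]
    have "((\<lambda>t. (x - t) ^ l *\<^sub>R F (Suc l) t) has_integral fact l * T x) {0..x}"
      by (simp add: scaleR_conv_of_real)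
    then have "((\<lambda>t. if t \<in> {0..x} then (x - t) ^ l *\<^sub>R F (Suc l) t else 0) has_integral fact l * T x) {0..M}"
      using x by (subst has_integral_restrict) auto
    then show ?thesis
      by (rule has_integral_eq[rotated]) (auto simp: K_def)
  qed
  have "((\<lambda>t. (\<Sum>k=1..n. K (a k) t *\<^sub>R F (Suc l) t) - (\<Sum>k=1..n. K (b k) t *\<^sub>R F (Suc l) t))
          has_integral (\<Sum>k=1..n. fact l * T (a k)) - (\<Sum>k=1..n. fact l * T (b k))) {0..M}"
    by (intro has_integral_diff has_integral_sum one) (use a b in auto)
  also have "(\<lambda>t. (\<Sum>k=1..n. K (a k) t *\<^sub>R F (Suc l) t) - (\<Sum>k=1..n. K (b k) t *\<^sub>R F (Suc l) t)) =
      (\<lambda>t. (-1) ^ (l + 1) * (rho l n a b t *\<^sub>R F (Suc l) t))"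
  proof
    fix t
    have "(\<Sum>k=1..n. K (a k) t *\<^sub>R F (Suc l) t) - (\<Sum>k=1..n. K (b k) t *\<^sub>R F (Suc l) t) =
      ((\<Sum>k=1..n. K (a k) t) - (\<Sum>k=1..n. K (b k) t)) *\<^sub>R F (Suc l) t"
      by (simp only: scaleR_sum_left scaleR_diff_left)
    also have "(\<Sum>k=1..n. K (a k) t) - (\<Sum>k=1..n. K (b k) t) = (-1) ^ (l + 1) * rho l n a b t"
      unfolding K_def by (rule rho_reflected[OF l pow])
    finally show "(\<Sum>k=1..n. K (a k) t *\<^sub>R F (Suc l) t) - (\<Sum>k=1..n. K (b k) t *\<^sub>R F (Suc l) t) =
        (-1) ^ (l + 1) * (rho l n a b t *\<^sub>R F (Suc l) t)"
      by (simp add: scaleR_conv_of_real)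
  qed
  also have "(\<Sum>k=1..n. fact l * T (a k)) - (\<Sum>k=1..n. fact l * T (b k)) =
      fact l * ((\<Sum>k=1..n. F 0 (a k)) - (\<Sum>k=1..n. F 0 (b k)))"
  proof -
    have poly: "(\<Sum>k=1..n. \<Sum>i\<le>l. (x k ^ i / fact i) *\<^sub>R F i 0) = (\<Sum>i\<le>l. ((\<Sum>k=1..n. x k ^ i) / fact i) *\<^sub>R F i 0)" for x
      by (subst sum.swap) (simp add: sum_divide_distrib scaleR_sum_left)
    have "(\<Sum>i\<le>l. ((\<Sum>k=1..n. a k ^ i) / fact i) *\<^sub>R F i 0) = (\<Sum>i\<le>l. ((\<Sum>k=1..n. b k ^ i) / fact i) *\<^sub>R F i 0)"
      using pow by (intro sum.cong) auto
    then have "(\<Sum>k=1..n. T (a k)) - (\<Sum>k=1..n. T (b k)) = (\<Sum>k=1..n. F 0 (a k)) - (\<Sum>k=1..n. F 0 (b k))"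
      unfolding T_def sum_subtractf poly by simp
    then show ?thesis by (simp only: sum_distrib_left[symmetric] right_diff_distrib[symmetric])
  qed
  finally have I: "((\<lambda>t. (-1) ^ (l + 1) * (rho l n a b t *\<^sub>R F (Suc l) t)) has_integral
      fact l * ((\<Sum>k=1..n. F 0 (a k)) - (\<Sum>k=1..n. F 0 (b k)))) {0..M}" .
  from has_integral_mult_right[OF I, of "(-1) ^ (l + 1)"]
  have I: "((\<lambda>t. rho l n a b t *\<^sub>R F (Suc l) t) has_integral
      (-1) ^ (l + 1) * fact l * ((\<Sum>k=1..n. F 0 (a k)) - (\<Sum>k=1..n. F 0 (b k)))) {0..M}"
    by (simp add: mult.assoc[symmetric] power_mult_distrib[symmetric])
  have int: "set_integrable lborel {0..M} (\<lambda>t. rho l n a b t *\<^sub>R F (Suc l) t)"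
    by (intro borel_integrable_atLeastAtMost' continuous_intros continuous_on_rho l cont)
  show ?thesis
    using set_borel_integral_eq_integral(2)[OF int] I by (simp add: integral_unique)
qed

section \<open>Integrals against sums of translates\<close>

lemma summable_on_imp_sums_indicator:
  fixes f :: "nat \<Rightarrow> 'a :: {t2_space, topological_comm_monoid_add}"
  assumes "f summable_on I"
  shows "(\<lambda>m. if m \<in> I then f m else 0) sums (\<Sum>\<^sub>\<infinity>m\<in>I. f m)"
proof (rule has_sum_imp_sums)
  show "((\<lambda>m. if m \<in> I then f m else 0) has_sum (\<Sum>\<^sub>\<infinity>m\<in>I. f m)) UNIV"
    using has_sum_infsum[OF assms] by (rule has_sum_cong_neutral[THEN iffD1, rotated -1]) auto
qed

text \<open>
  The terms of the convergent series tend to zero, whereas each \<open>m\<close> with \<open>lam m \<le> t\<close> contributes at least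
  \<open>1 / (1 + t) ^ q\<close>.
\<close>

lemma finite_bounded_shifts:
  fixes lam :: "nat \<Rightarrow> real"
  assumes lam: "\<forall>m\<in>I. 0 \<le> lam m" and sm: "(\<lambda>m. 1 / (1 + lam m) ^ q) summable_on I"
  shows "finite {m\<in>I. lam m \<le> t}"
proof (cases "t \<ge> 0")
  case True
  have "(\<lambda>m. if m \<in> I then 1 / (1 + lam m) ^ q else 0) \<longlonglongrightarrow> 0"
    by (rule summable_LIMSEQ_zero[OF sums_summable[OF summable_on_imp_sums_indicator[OF sm]]])
  then have "\<forall>\<^sub>F m in sequentially. (if m \<in> I then 1 / (1 + lam m) ^ q else 0) < 1 / (1 + t) ^ q"
    by (rule order_tendstoD) (use True in simp)
  then have "\<forall>\<^sub>F m in cofinite. (if m \<in> I then 1 / (1 + lam m) ^ q else 0) < 1 / (1 + t) ^ q"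
    unfolding cofinite_eq_sequentially .
  then have "\<forall>\<^sub>F m in cofinite. \<not> (m \<in> I \<and> lam m \<le> t)"
  proof eventually_elim
    case (elim m)
    show ?case
    proof
      assume m: "m \<in> I \<and> lam m \<le> t"
      then have "1 / (1 + t) ^ q \<le> 1 / (1 + lam m) ^ q"
        using lam True by (intro divide_left_mono power_mono mult_pos_pos zero_less_power) auto
      then show False using elim m by simp
    qed
  qed
  then show ?thesis by (simp add: eventually_cofinite)
next
  case False
  then have "{m\<in>I. lam m \<le> t} = {}" using lam by force
  then show ?thesis by (metis finite.emptyI)
qed

text \<open>
  A bounded function \<open>R\<close> supported in \<open>{0..M}\<close>, translated by the numbers \<open>lam m\<close>.  Locally only
  finitely many translates are active, so their sum exists at every point.
\<close>

context
  fixes I :: "nat set" and lam :: "nat \<Rightarrow> real" and q :: nat and R :: "real \<Rightarrow> real" and B M :: real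
  assumes lam: "\<forall>m\<in>I. 0 \<le> lam m" and sm: "(\<lambda>m. 1 / (1 + lam m) ^ q) summable_on I"
    and Rmeas [measurable]: "R \<in> borel_measurable borel"
    and Rbd: "\<And>t. \<bar>R t\<bar> \<le> B" and R0: "\<And>t. t < 0 \<or> t > M \<Longrightarrow> R t = 0"
begin

lemma finite_active_shifts: "finite {m\<in>I. R (t - lam m) \<noteq> 0}"
proof (rule finite_subset[OF _ finite_bounded_shifts[OF lam sm, of t]])
  show "{m\<in>I. R (t - lam m) \<noteq> 0} \<subseteq> {m\<in>I. lam m \<le> t}"
    using R0 by force
qed

lemma shifts_summable_on: "(\<lambda>m. R (t - lam m)) summable_on I"
  by (rule finite_nonzero_values_imp_summable_on[OF finite_active_shifts])

lemma shifts_borel_measurable: "(\<lambda>t. \<Sum>\<^sub>\<infinity>m\<in>I. R (t - lam m)) \<in> borel_measurable borel"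
proof -
  have "(\<Sum>\<^sub>\<infinity>m\<in>I. R (t - lam m)) = (\<Sum>m. if m \<in> I then R (t - lam m) else 0)" for t
    using summable_on_imp_sums_indicator[OF shifts_summable_on] by (rule sums_unique)
  moreover have "(\<lambda>t. if m \<in> I then R (t - lam m) else 0) \<in> borel_measurable borel" for m
    by (cases "m \<in> I") simp_all
  ultimately show ?thesis by (simp add: borel_measurable_suminf)
qed

text \<open>
  After the substitution \<open>t \<mapsto> t + lam m\<close> the \<open>m\<close>-th term is dominated by
  \<open>B C / (1 + lam m) ^ q\<close> on \<open>{0..M}\<close>.  Hence the integrals of the absolute values are summable, and sum
  and integral may be exchanged both before and after the substitution.
\<close>

lemma sum_of_shifts_integral:
  fixes G :: "real \<Rightarrow> complex"
  assumes Gmeas [measurable]: "G \<in> borel_measurable borel"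
    and Gbd: "\<And>t. t \<ge> 0 \<Longrightarrow> norm (G t) \<le> C / (1 + t) ^ q"
  shows "integrable lborel (\<lambda>t. (\<Sum>\<^sub>\<infinity>m\<in>I. R (t - lam m)) *\<^sub>R G t)"
    and "(LINT t|lborel. (\<Sum>\<^sub>\<infinity>m\<in>I. R (t - lam m)) *\<^sub>R G t) =
           (LINT t|lborel. R t *\<^sub>R (\<Sum>\<^sub>\<infinity>m\<in>I. G (t + lam m)))"
proof -
  have B0: "B \<ge> 0" using Rbd[of 0] by linarith
  have C0: "C \<ge> 0" using Gbd[of 0] norm_ge_zero[of "G 0"] by (simp del: norm_ge_zero)
  define w where "w = (\<lambda>m. if m \<in> I then 1 / (1 + lam m) ^ q else 0)"
  have w: "summable w"
    unfolding w_def by (rule sums_summable[OF summable_on_imp_sums_indicator[OF sm]])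
  have Gshift: "norm (G (t + lam m)) \<le> C / (1 + lam m) ^ q" if "m \<in> I" "t \<ge> 0" for m t
  proof -
    have "norm (G (t + lam m)) \<le> C / (1 + (t + lam m)) ^ q"
      using that lam by (intro Gbd) auto
    also have "\<dots> \<le> C / (1 + lam m) ^ q"
      using that lam C0 by (intro divide_left_mono power_mono mult_pos_pos zero_less_power) (auto simp: add_pos_nonneg)
    finally show ?thesis .
  qed
  \<comment> \<open>\<open>F m\<close> is \<open>H m\<close> translated; the dominating function is written down for \<open>H m\<close>\<close>
  define H where "H = (\<lambda>m t. if m \<in> I then R t *\<^sub>R G (t + lam m) else 0)"
  define F where "F = (\<lambda>m t. if m \<in> I then R (t - lam m) *\<^sub>R G t else 0)"
  have FH: "F m t = H m (- lam m + 1 * t)" for m t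
    by (simp add: F_def H_def)
  have Hmeas [measurable]: "H m \<in> borel_measurable borel" for m
    unfolding H_def by (cases "m \<in> I") simp_all
  have Hbd: "norm (H m t) \<le> indicator {0..M} t * (B * C * w m)" for m t
  proof (cases "m \<in> I \<and> t \<in> {0..M}")
    case True
    then have "\<bar>R t\<bar> * norm (G (t + lam m)) \<le> B * (C / (1 + lam m) ^ q)"
      using Rbd Gshift B0 by (intro mult_mono) auto
    then show ?thesis using True by (simp add: H_def w_def)
  next
    case False
    then show ?thesis using R0[of t] B0 C0 lam by (auto simp: H_def w_def not_le)
  qed
  have Bint: "integrable lborel (\<lambda>t. indicator {0..M} t * (B * C * w m))" for m
    by (intro integrable_mult_left integrable_real_indicator emeasure_compact_finite) auto
  have Hint: "integrable lborel (H m)" for m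
    by (rule Bochner_Integration.integrable_bound[OF Bint]) (use Hbd in \<open>auto intro: order.trans[OF _ abs_ge_self]\<close>)
  have Fint: "integrable lborel (F m)" for m
    unfolding FH[abs_def] by (intro lborel_integrable_real_affine Hint) auto
  have Fint_eq: "(LINT t|lborel. F m t) = (LINT t|lborel. H m t)" for m
    using lborel_integral_real_affine[of 1 "H m" "- lam m"] by (simp add: FH)
  have Fnorm_eq: "(LINT t|lborel. norm (F m t)) = (LINT t|lborel. norm (H m t))" for m
    using lborel_integral_real_affine[of 1 "\<lambda>t. norm (H m t)" "- lam m"] by (simp add: FH)
  have Hnorm: "(LINT t|lborel. norm (H m t)) \<le> (LINT t|lborel. indicator {0..M} t * (B * C)) * w m" for m
  proof -
    have "(LINT t|lborel. norm (H m t)) \<le> (LINT t|lborel. indicator {0..M} t * (B * C * w m))"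
      by (intro integral_mono integrable_norm Hint Bint Hbd)
    then show ?thesis by simp
  qed
  have Hsum: "summable (\<lambda>m. LINT t|lborel. norm (H m t))"
    by (rule summable_comparison_test'[OF summable_mult[OF w], of 0]) (use Hnorm in simp)
  have Hpt: "summable (\<lambda>m. norm (H m t))" for t
  proof (rule summable_comparison_test'[OF summable_mult[OF w, of "indicator {0..M} t * (B * C)"], of 0])
    show "norm (norm (H m t)) \<le> indicator {0..M} t * (B * C) * w m" for m
      using Hbd[of m t] by (simp add: mult_ac)
  qed
  have Fpt: "summable (\<lambda>m. norm (F m t))" for t
    by (rule summable_finite[OF finite_active_shifts[of t]]) (auto simp: F_def)
  have Fsum: "(\<Sum>m. F m t) = (\<Sum>\<^sub>\<infinity>m\<in>I. R (t - lam m)) *\<^sub>R G t" for t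
  proof -
    have "(\<lambda>m. (if m \<in> I then R (t - lam m) else 0) *\<^sub>R G t) sums ((\<Sum>\<^sub>\<infinity>m\<in>I. R (t - lam m)) *\<^sub>R G t)"
      by (intro sums_scaleR_left summable_on_imp_sums_indicator shifts_summable_on)
    also have "(\<lambda>m. (if m \<in> I then R (t - lam m) else 0) *\<^sub>R G t) = (\<lambda>m. F m t)"
      by (auto simp: F_def)
    finally show ?thesis by (simp add: sums_iff)
  qed
  have Hsum_eq: "(\<Sum>m. H m t) = R t *\<^sub>R (\<Sum>\<^sub>\<infinity>m\<in>I. G (t + lam m))" for t
  proof (cases "R t = 0")
    case False
    then have t: "t \<ge> 0" using R0[of t] by (cases "t < 0") auto
    have "(\<lambda>m. G (t + lam m)) summable_on I"
    proof (rule abs_summable_summable, rule summable_on_comparison_test)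
      show "(\<lambda>m. C * (1 / (1 + lam m) ^ q)) summable_on I"
        by (intro summable_on_cmult_right sm)
    qed (use Gshift t in auto)
    then have "(\<lambda>m. R t *\<^sub>R (if m \<in> I then G (t + lam m) else 0)) sums (R t *\<^sub>R (\<Sum>\<^sub>\<infinity>m\<in>I. G (t + lam m)))"
      by (intro sums_scaleR_right summable_on_imp_sums_indicator)
    also have "(\<lambda>m. R t *\<^sub>R (if m \<in> I then G (t + lam m) else 0)) = (\<lambda>m. H m t)"
      by (auto simp: H_def)
    finally show ?thesis by (simp add: sums_iff)
  next
    case True
    then have "(\<lambda>m. H m t) = (\<lambda>_. 0)" by (auto simp: H_def)
    then show ?thesis using True by simp
  qed
  note F = AE_I2[of lborel, OF Fpt] Hsum[folded Fnorm_eq]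
  note H = AE_I2[of lborel, OF Hpt] Hsum
  show "integrable lborel (\<lambda>t. (\<Sum>\<^sub>\<infinity>m\<in>I. R (t - lam m)) *\<^sub>R G t)"
    using integrable_suminf[OF Fint F] by (simp add: Fsum)
  show "(LINT t|lborel. (\<Sum>\<^sub>\<infinity>m\<in>I. R (t - lam m)) *\<^sub>R G t) =
           (LINT t|lborel. R t *\<^sub>R (\<Sum>\<^sub>\<infinity>m\<in>I. G (t + lam m)))"
    using integral_suminf[OF Fint F] integral_suminf[OF Hint H]
    by (simp add: Fsum Hsum_eq Fint_eq)
qed

end

section \<open>Laplace transforms\<close>

text \<open>
  A single term of the exponential series: \<open>(s (1 + t)) ^ q / q! \<le> exp (s (1 + t))\<close>.
\<close>

lemma exp_decay_bound:
  assumes s: "(s::real) > 0"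
  obtains C where "\<And>t. t \<ge> 0 \<Longrightarrow> exp (- s * t) \<le> C / (1 + t) ^ q"
proof
  fix t :: real assume t: "t \<ge> 0"
  have "(s * (1 + t)) ^ q / fact q \<le> (\<Sum>k. (s * (1 + t)) ^ k / fact k)"
    using sum_le_suminf[OF summable_exp[of "s * (1 + t)"], of "{q}"] s t
    by (simp add: divide_inverse mult.commute)
  also have "\<dots> = exp (s * (1 + t))"
    by (simp add: exp_def divide_inverse mult.commute)
  also have "\<dots> = exp s * exp (s * t)"
    by (simp add: distrib_left exp_add)
  finally have "s ^ q * (1 + t) ^ q / fact q \<le> exp s * exp (s * t)"
    by (simp only: power_mult_distrib)
  then show "exp (- s * t) \<le> (exp s * fact q / s ^ q) / (1 + t) ^ q"
    using s t by (simp add: exp_minus divide_simps mult_ac)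
qed

text \<open>
  In absolute value this is the integrand of Euler's integral for \<open>Gamma (p + 1)\<close>, rescaled by \<open>Re w\<close>.
\<close>

lemma laplace_power_integrable:
  assumes w: "Re w > 0"
  shows "set_integrable lborel {0<..} (\<lambda>s. of_real (s ^ p) * exp (- (of_real s * w)))"
proof -
  have "(\<lambda>t. complex_of_real t powr (of_nat (Suc p) - 1) / of_real (exp (Re w * t)))
         absolutely_integrable_on {0<..}"
    using w by (intro absolutely_integrable_Gamma_integral) auto
  then have "integrable lebesgue (\<lambda>t. indicator {0<..} t *\<^sub>R (complex_of_real t powr (of_nat (Suc p) - 1) / of_real (exp (Re w * t))))"
    by (simp add: set_integrable_def)
  also have "(\<lambda>t. indicator {0<..} t *\<^sub>R (complex_of_real t powr (of_nat (Suc p) - 1) / of_real (exp (Re w * t))))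
     = (\<lambda>t. indicator {0<..} t *\<^sub>R (complex_of_real t ^ p * of_real (exp (- (Re w * t)))))"
    by (intro ext) (auto simp: indicator_def exp_minus divide_inverse powr_nat' )
  finally have "integrable lborel (\<lambda>t. indicator {0<..} t *\<^sub>R (complex_of_real t ^ p * of_real (exp (- (Re w * t)))))"
    by (subst (asm) integrable_completion) auto
  then show ?thesis unfolding set_integrable_def
    by (rule Bochner_Integration.integrable_bound)
       (auto simp: norm_mult norm_power mult_ac indicator_def intro!: AE_I2)
qed

lemma tendsto_power_times_exp_at_top:
  assumes w: "Re w > 0"
  shows "((\<lambda>s. of_real (s ^ p) * exp (- (of_real s * w))) \<longlongrightarrow> 0) at_top"
proof (rule tendsto_norm_zero_cancel)
  have "((\<lambda>s. s ^ p * exp (- (s * Re w))) \<longlongrightarrow> 0) at_top"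
    using w by real_asymp
  moreover have "\<forall>\<^sub>F s in at_top. s ^ p * exp (- (s * Re w)) = norm (of_real (s ^ p) * exp (- (of_real s * w)))"
    using eventually_gt_at_top[of 0] by eventually_elim (simp add: norm_mult norm_power)
  ultimately show "((\<lambda>s. norm (of_real (s ^ p) * exp (- (of_real s * w)))) \<longlongrightarrow> 0) at_top"
    by (rule Lim_transform_eventually)
qed

text \<open>
  Let \<open>J(p)\<close> be the integral.  Integrating the derivative of \<open>s ^ p * exp (- s w)\<close> over the half-line gives
  \<open>w J(p) = p J(p - 1)\<close> for \<open>p \<ge> 1\<close> and \<open>w J(0) = 1\<close>.
\<close>

lemma laplace_power:
  assumes w: "Re w > 0"
  shows "(LINT s:{0<..}|lborel. of_real (s ^ p) * exp (- (of_real s * w))) = fact p / w ^ Suc p"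
proof (induction p)
  define J where "J = (\<lambda>p. LINT s:{0<..}|lborel. of_real (s ^ p) * exp (- (of_real s * w)))"
  have w0: "w \<noteq> 0" using w by auto
  have ftc: "of_nat p * J (p - 1) - w * J p = - (if p = 0 then 1 else 0)" for p
  proof -
    let ?F = "\<lambda>s. complex_of_real (s ^ p) * exp (- (of_real s * w))"
    let ?f = "\<lambda>s. of_nat p * (complex_of_real (s ^ (p - 1)) * exp (- (of_real s * w))) -
                   w * (complex_of_real (s ^ p) * exp (- (of_real s * w)))"
    have int: "set_integrable lborel {0<..} ?f"
      using laplace_power_integrable[OF w] by (intro set_integral_diff set_integrable_mult_right) auto
    have "(LBINT s=0..\<infinity>. ?f s) = 0 - (if p = 0 then 1 else 0)"
    proof (rule interval_integral_FTC_integrable[where F = ?F])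
      fix s :: real
      have "((\<lambda>u. u ^ p * exp (- (u * w))) has_field_derivative
              of_nat p * (of_real s ^ (p - 1) * exp (- (of_real s * w))) - w * (of_real s ^ p * exp (- (of_real s * w)))) (at (of_real s))"
        by (auto intro!: derivative_eq_intros simp: algebra_simps)
      from has_vector_derivative_real_field[OF this]
      show "(?F has_vector_derivative ?f s) (at s)" by simp
      show "isCont ?f s" by (intro continuous_intros)
    next
      show "set_integrable lborel (einterval 0 \<infinity>) ?f"
        using int by (simp add: einterval_eq_Ici zero_ereal_def)
    next
      have "(?F \<longlongrightarrow> ?F 0) (at_right 0)"
        by (intro tendsto_intros)
      moreover have "?F 0 = (if p = 0 then 1 else 0)" by (simp add: power_0_left)
      ultimately have "(?F \<longlongrightarrow> (if p = 0 then 1 else 0)) (at_right 0)" by (simp only:)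
      then show "((?F \<circ> real_of_ereal) \<longlongrightarrow> (if p = 0 then 1 else 0)) (at_right 0)"
        by (simp only: ereal_tendsto_simps zero_ereal_def)
    next
      show "((?F \<circ> real_of_ereal) \<longlongrightarrow> 0) (at_left \<infinity>)"
        using tendsto_power_times_exp_at_top[OF w] by (simp add: ereal_tendsto_simps)
    qed simp
    also have "(LBINT s=0..\<infinity>. ?f s) = (LINT s:{0<..}|lborel. ?f s)"
      by (simp add: interval_lebesgue_integral_def zero_ereal_def einterval_eq_Ici)
    also have "\<dots> = of_nat p * J (p - 1) - w * J p"
      unfolding J_def using laplace_power_integrable[OF w]
      by (subst set_integral_diff) (auto intro!: set_integrable_mult_right)
    finally show ?thesis by simp
  qed
  {
    case 0
    show ?case using ftc[of 0] w0 by (simp add: J_def field_simps)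
  next
    case (Suc p)
    have "w * J (Suc p) = of_nat (Suc p) * J p" using ftc[of "Suc p"] by simp
    moreover have "J p = fact p / w ^ Suc p" using Suc.IH by (simp add: J_def)
    ultimately have "J (Suc p) = of_nat (Suc p) * (fact p / w ^ Suc p) / w"
      using w0 by (simp add: eq_divide_eq mult.commute mult.left_commute del: of_nat_Suc power_Suc)
    then show ?case unfolding J_def by (simp add: mult_ac)
  }
qed

text \<open>
  Write \<open>p! / (z + t) ^ (p + 1)\<close> as a Laplace integral in \<open>s\<close> and integrate first over \<open>t\<close>.  The
  absolute value of the double integrand is the same expression with \<open>Re z\<close> in place of \<open>z\<close>, so absolute
  convergence is the integrability of \<open>\<Phi>(t) / (Re z + t) ^ (p + 1)\<close>.
\<close>

lemma laplace_stieltjes_fubini: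
  fixes \<Phi> :: "real \<Rightarrow> real"
  assumes [measurable]: "\<Phi> \<in> borel_measurable borel" and \<Phi>0: "\<And>t. t \<le> 0 \<Longrightarrow> \<Phi> t = 0"
    and z: "Re z > 0" and int: "integrable lborel (\<lambda>t. \<Phi> t *\<^sub>R (1 / (z + of_real t) ^ Suc p))"
    and intRe: "integrable lborel (\<lambda>t. \<Phi> t *\<^sub>R (1 / (of_real (Re z) + of_real t :: complex) ^ Suc p))"
  shows "set_integrable lborel {0<..} (\<lambda>s. of_real (s ^ p) * exp (- (of_real s * z)) *
            (LINT t|lborel. \<Phi> t *\<^sub>R exp (- (of_real s * of_real t))))" (is ?int)
    and "(LINT s:{0<..}|lborel. of_real (s ^ p) * exp (- (of_real s * z)) *
            (LINT t|lborel. \<Phi> t *\<^sub>R exp (- (of_real s * of_real t)))) =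
          fact p * (LINT t|lborel. \<Phi> t *\<^sub>R (1 / (z + of_real t) ^ Suc p))" (is ?eq)
proof -
  define f :: "real \<Rightarrow> real \<Rightarrow> complex" where
    "f = (\<lambda>t s. \<Phi> t *\<^sub>R (indicator {0<..} s *\<^sub>R (of_real (s ^ p) * exp (- (of_real s * (z + of_real t))))))"
  have inner: "integrable lborel (f t)" "(LINT s|lborel. f t s) = fact p * \<Phi> t *\<^sub>R (1 / (z + of_real t) ^ Suc p)"
    "(LINT s|lborel. norm (f t s)) = norm (fact p * \<Phi> t *\<^sub>R (1 / (of_real (Re z) + of_real t :: complex) ^ Suc p))" for t
  proof -
    have "integrable lborel (f t) \<and> (LINT s|lborel. f t s) = fact p * \<Phi> t *\<^sub>R (1 / (z + of_real t) ^ Suc p) \<and>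
      (LINT s|lborel. norm (f t s)) = norm (fact p * \<Phi> t *\<^sub>R (1 / (of_real (Re z) + of_real t :: complex) ^ Suc p))"
    proof (cases "t \<le> 0")
      case True
      then have "f t = (\<lambda>_. 0)" using \<Phi>0 by (auto simp: f_def)
      then show ?thesis using True \<Phi>0 by simp
    next
      case False
      then have re: "Re (z + of_real t) > 0" "Re (of_real (Re z) + of_real t) > 0" using z by auto
      let ?x = "of_real (Re z) + of_real t :: complex"
      have "integrable lborel (f t)"
        using laplace_power_integrable[OF re(1), of p] unfolding f_def set_integrable_def
        by (intro integrable_scaleR_right)
      moreover have "(LINT s|lborel. f t s) = fact p * \<Phi> t *\<^sub>R (1 / (z + of_real t) ^ Suc p)"
        using laplace_power[OF re(1), of p] unfolding f_def set_lebesgue_integral_def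
        by (simp add: scaleR_conv_of_real)
      moreover have "(LINT s|lborel. norm (f t s)) = norm (fact p * \<Phi> t *\<^sub>R (1 / ?x ^ Suc p))"
      proof -
        have nrm: "norm (f t s) = \<bar>\<Phi> t\<bar> * (indicator {0<..} s * (s ^ p * exp (- (s * (Re z + t)))))" for s
          by (auto simp: f_def indicator_def norm_mult norm_power)
        have "complex_of_real (LINT s|lborel. indicator {0<..} s * (s ^ p * exp (- (s * (Re z + t)))))
           = (LINT s:{0<..}|lborel. of_real (s ^ p) * exp (- (of_real s * ?x)))"
          unfolding set_lebesgue_integral_def integral_complex_of_real[symmetric]
          by (intro Bochner_Integration.integral_cong) (auto simp: indicator_def simp flip: exp_of_real)
        also have "\<dots> = of_real (fact p / (Re z + t) ^ Suc p)"
          using laplace_power[OF re(2), of p] by simp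
        finally have "(LINT s|lborel. indicator {0<..} s * (s ^ p * exp (- (s * (Re z + t))))) = fact p / (Re z + t) ^ Suc p"
          by (simp only: of_real_eq_iff)
        moreover have "norm ?x = Re z + t" using z False by (simp flip: of_real_add)
        ultimately show ?thesis unfolding nrm by (simp add: norm_mult norm_divide norm_power)
      qed
      ultimately show ?thesis by blast
    qed
    then show "integrable lborel (f t)" "(LINT s|lborel. f t s) = fact p * \<Phi> t *\<^sub>R (1 / (z + of_real t) ^ Suc p)"
      "(LINT s|lborel. norm (f t s)) = norm (fact p * \<Phi> t *\<^sub>R (1 / (of_real (Re z) + of_real t :: complex) ^ Suc p))" by auto
  qed
  have F: "integrable (lborel \<Otimes>\<^sub>M lborel) (case_prod f)"
  proof (rule lborel_pair.Fubini_integrable)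
    show "case_prod f \<in> borel_measurable (lborel \<Otimes>\<^sub>M lborel)"
      unfolding f_def by measurable
    show "integrable lborel (\<lambda>t. LINT s|lborel. norm (case_prod f (t, s)))"
      unfolding case_prod_conv inner(3) by (intro integrable_norm integrable_mult_right intRe)
  qed (use inner(1) in simp)
  have outer: "(LINT t|lborel. f t s) = indicator {0<..} s *\<^sub>R (of_real (s ^ p) * exp (- (of_real s * z)) *
            (LINT t|lborel. \<Phi> t *\<^sub>R exp (- (of_real s * of_real t))))" for s
  proof -
    define K where "K = indicator {0<..} s *\<^sub>R (complex_of_real (s ^ p) * exp (- (of_real s * z)))"
    have "f t s = K * (\<Phi> t *\<^sub>R exp (- (of_real s * of_real t)))" for t
      by (simp add: f_def K_def exp_add[symmetric] algebra_simps scaleR_conv_of_real)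
    then have "(LINT t|lborel. f t s) = K * (LINT t|lborel. \<Phi> t *\<^sub>R exp (- (of_real s * of_real t)))"
      by (simp only: integral_mult_right_zero)
    then show ?thesis by (simp add: K_def)
  qed
  show ?int using lborel_pair.integrable_snd[OF F] unfolding outer set_integrable_def .
  show ?eq using lborel_pair.Fubini_integral[OF F] 
    unfolding outer inner(2) set_lebesgue_integral_def integral_mult_right_zero .
qed

section \<open>The kernels of the theorem\<close>

text \<open>
  The series for the derivative of order \<open>p + 1\<close> converges at \<open>z = 1\<close>, where all its terms have the same
  sign, so the common factor \<open>(-1)\<^sup>p p!\<close> can be divided out.
\<close>

lemma class_E_zeros_summable:
  assumes "f \<in> class_E p" "p \<ge> 1" "lists_zeros f N lam"
  shows "(\<lambda>m. 1 / (1 + lam m) ^ Suc p) summable_on index_set N"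
proof -
  have "(\<lambda>m. (-1) ^ p * fact p / (1 + of_real (lam m)) ^ Suc p :: complex) summable_on index_set N"
    using higher_deriv_log_branch[OF assms, of 1] by (auto simp: summable_on_def)
  then have "(\<lambda>m. ((-1) ^ p / fact p) * ((-1) ^ p * fact p / (1 + of_real (lam m)) ^ Suc p :: complex)) summable_on index_set N"
    by (rule summable_on_cmult_right)
  then have "(\<lambda>m. Re (((-1) ^ p / fact p) * ((-1) ^ p * fact p / (1 + of_real (lam m)) ^ Suc p))) summable_on index_set N"
    by (rule summable_on_Re)
  also have "(\<lambda>m. Re (((-1) ^ p / fact p) * ((-1) ^ p * fact p / (1 + of_real (lam m)) ^ Suc p)))
           = (\<lambda>m. 1 / (1 + lam m) ^ Suc p)"
  proof
    fix m
    have "((-1) ^ p / fact p) * ((-1) ^ p * fact p / (1 + of_real (lam m)) ^ Suc p) =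
          (complex_of_real (1 / (1 + lam m) ^ Suc p))"
      by (simp add: power_mult_distrib[symmetric])
    then show "Re (((-1) ^ p / fact p) * ((-1) ^ p * fact p / (1 + of_real (lam m)) ^ Suc p)) = 1 / (1 + lam m) ^ Suc p"
      by (simp only: Re_complex_of_real)
  qed
  finally show ?thesis .
qed

text \<open>
  The nodes and the list of zeros as data of their own; the last assumption is the growth condition on
  the zeros that membership of \<open>f\<close> in the class entails.
\<close>

locale matched_shifts =
  fixes p l n :: nat and N :: enat and lam a b :: "nat \<Rightarrow> real"
  assumes l1: "1 \<le> l"
    and lam0: "\<forall>m\<in>index_set N. 0 \<le> lam m"
    and a0: "\<forall>k\<in>{1..n}. 0 \<le> a k" and b0: "\<forall>k\<in>{1..n}. 0 \<le> b k"
    and pow: "\<forall>j\<le>l. (\<Sum>k=1..n. a k ^ j) = (\<Sum>k=1..n. b k ^ j)"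
    and sm: "(\<lambda>m. 1 / (1 + lam m) ^ Suc p) summable_on index_set N"
begin

abbreviation "\<rho> \<equiv> rho l n a b"
abbreviation "\<phi> \<equiv> phi N lam l n a b"

text \<open>
  Any common upper bound of the nodes serves; the sum is one also when \<open>n = 0\<close>.
\<close>

definition M :: real where "M = (\<Sum>k=1..n. a k) + (\<Sum>k=1..n. b k)"

lemma a_le_M: "\<forall>k\<in>{1..n}. 0 \<le> a k \<and> a k \<le> M"
proof
  fix k assume k: "k \<in> {1..n}"
  have "a k \<le> (\<Sum>k=1..n. a k)" using k a0 by (intro member_le_sum) auto
  moreover have "0 \<le> (\<Sum>k=1..n. b k)" using b0 by (intro sum_nonneg) auto
  ultimately show "0 \<le> a k \<and> a k \<le> M" using k a0 by (simp add: M_def)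
qed

lemma b_le_M: "\<forall>k\<in>{1..n}. 0 \<le> b k \<and> b k \<le> M"
proof
  fix k assume k: "k \<in> {1..n}"
  have "b k \<le> (\<Sum>k=1..n. b k)" using k b0 by (intro member_le_sum) auto
  moreover have "0 \<le> (\<Sum>k=1..n. a k)" using a0 by (intro sum_nonneg) auto
  ultimately show "0 \<le> b k \<and> b k \<le> M" using k b0 by (simp add: M_def)
qed

lemma rho_nonpos: "t \<le> 0 \<Longrightarrow> \<rho> t = 0"
  using rho_eq_0_left[OF l1 a0 b0] .

lemma rho_outside: "t < 0 \<or> t > M \<Longrightarrow> \<rho> t = 0"
  using rho_nonpos[of t] rho_eq_0_right[OF l1 pow, of M t] a_le_M b_le_M by auto

lemma rho_measurable [measurable]: "\<rho> \<in> borel_measurable borel"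
  by (intro borel_measurable_continuous_onI continuous_on_rho l1)

lemma rho_bounded: obtains B where "\<And>t. \<bar>\<rho> t\<bar> \<le> B"
proof -
  have "bounded (\<rho> ` {0..M})"
    by (intro compact_imp_bounded compact_continuous_image continuous_on_rho l1) auto
  then obtain B where B: "\<forall>t\<in>{0..M}. \<bar>\<rho> t\<bar> \<le> B"
    by (auto simp: bounded_iff)
  have "\<bar>\<rho> t\<bar> \<le> max B 0" for t
    using B rho_outside[of t] by (cases "t \<in> {0..M}") (force simp: le_max_iff_disj)+
  then show ?thesis by (rule that)
qed

lemma rho_set_integral:
  "(LINT t:{0..M}|lborel. \<rho> t *\<^sub>R g t) = (LINT t|lborel. \<rho> t *\<^sub>R (g t :: complex))"
proof -
  have "indicator {0..M} t *\<^sub>R (\<rho> t *\<^sub>R g t) = \<rho> t *\<^sub>R g t" for t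
    using rho_outside[of t] by (cases "t \<in> {0..M}") auto
  then show ?thesis by (simp only: set_lebesgue_integral_def)
qed

lemma rho_summable_on: "(\<lambda>m. \<rho> (t - lam m)) summable_on index_set N"
  using rho_bounded shifts_summable_on[OF lam0 sm rho_measurable _ rho_outside] by metis

lemma phi_measurable [measurable]: "\<phi> \<in> borel_measurable borel"
  unfolding phi_def[abs_def]
  using rho_bounded shifts_borel_measurable[OF lam0 sm rho_measurable _ rho_outside] by metis

lemma phi_nonpos: "t \<le> 0 \<Longrightarrow> \<phi> t = 0"
  unfolding phi_def using lam0 by (intro infsum_0 rho_nonpos) force

lemma
  fixes G :: "real \<Rightarrow> complex"
  assumes "G \<in> borel_measurable borel" "\<And>t. t \<ge> 0 \<Longrightarrow> norm (G t) \<le> C / (1 + t) ^ Suc p"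
  shows phi_integrable: "integrable lborel (\<lambda>t. \<phi> t *\<^sub>R G t)"
    and phi_integral: "(LINT t|lborel. \<phi> t *\<^sub>R G t) =
           (LINT t|lborel. \<rho> t *\<^sub>R (\<Sum>\<^sub>\<infinity>m\<in>index_set N. G (t + lam m)))"
proof -
  obtain B where B: "\<And>t. \<bar>\<rho> t\<bar> \<le> B" using rho_bounded by blast
  note * = sum_of_shifts_integral[OF lam0 sm rho_measurable B rho_outside assms]
  show "integrable lborel (\<lambda>t. \<phi> t *\<^sub>R G t)"
    unfolding phi_def by (rule *(1))
  show "(LINT t|lborel. \<phi> t *\<^sub>R G t) =
           (LINT t|lborel. \<rho> t *\<^sub>R (\<Sum>\<^sub>\<infinity>m\<in>index_set N. G (t + lam m)))"
    unfolding phi_def by (rule *(2))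
qed

lemma rho_peano:
  fixes F :: "nat \<Rightarrow> real \<Rightarrow> complex"
  assumes "\<And>j t. 0 \<le> t \<Longrightarrow> (F j has_vector_derivative F (Suc j) t) (at t)"
  shows "(LINT t|lborel. \<rho> t *\<^sub>R F (Suc l) t) =
           (-1) ^ (l + 1) * fact l * ((\<Sum>k=1..n. F 0 (a k)) - (\<Sum>k=1..n. F 0 (b k)))"
proof -
  have "continuous_on {0..M} (F (Suc l))"
    by (intro continuous_at_imp_continuous_on ballI has_vector_derivative_continuous[OF assms]) auto
  from peano_kernel[OF l1 pow a_le_M b_le_M assms this] show ?thesis
    by (simp only: rho_set_integral)
qed

lemma exp_summable_on:
  assumes "s > 0"
  shows "(\<lambda>m. exp (- lam m * s)) summable_on index_set N"
proof -
  obtain C where C: "\<And>t. t \<ge> 0 \<Longrightarrow> exp (- s * t) \<le> C / (1 + t) ^ Suc p"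
    using exp_decay_bound[OF assms] by blast
  show ?thesis
  proof (rule summable_on_comparison_test)
    show "(\<lambda>m. C * (1 / (1 + lam m) ^ Suc p)) summable_on index_set N"
      by (intro summable_on_cmult_right sm)
    show "exp (- lam m * s) \<le> C * (1 / (1 + lam m) ^ Suc p)" if "m \<in> index_set N" for m
      using C[of "lam m"] lam0 that by (simp add: mult.commute)
  qed auto
qed

text \<open>
  The Peano formula for \<open>F(t) = exp (- s t)\<close>, whose derivative of order \<open>l + 1\<close> is
  \<open>(- s) ^ (l + 1) * exp (- s t)\<close>.
\<close>

lemma laplace_rho:
  assumes s: "s > 0"
  shows "(LINT t|lborel. \<rho> t *\<^sub>R exp (- (complex_of_real s * of_real t))) = of_real (fact l * g_fun l n a b s)"
proof -
  define F :: "nat \<Rightarrow> real \<Rightarrow> complex" where "F = (\<lambda>j t. (- of_real s) ^ j * exp (- (of_real s * of_real t)))"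
  have "(F j has_vector_derivative F (Suc j) t) (at t)" if "0 \<le> t" for j t
  proof -
    have "((\<lambda>u. (- of_real s) ^ j * exp (- (of_real s * u))) has_field_derivative F (Suc j) t) (at (of_real t))"
      by (auto intro!: derivative_eq_intros simp: F_def)
    then show ?thesis unfolding F_def by (rule has_vector_derivative_real_field)
  qed
  from rho_peano[where F = F, OF this]
  have "(LINT t|lborel. \<rho> t *\<^sub>R F (Suc l) t) =
      (-1) ^ (l + 1) * fact l * ((\<Sum>k=1..n. F 0 (a k)) - (\<Sum>k=1..n. F 0 (b k)))" .
  also have "(LINT t|lborel. \<rho> t *\<^sub>R F (Suc l) t) =
      (- of_real s) ^ Suc l * (LINT t|lborel. \<rho> t *\<^sub>R exp (- (complex_of_real s * of_real t)))"
    unfolding F_def by (simp only: mult_scaleR_right[symmetric] integral_mult_right_zero)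
  also have "(\<Sum>k=1..n. F 0 (a k)) - (\<Sum>k=1..n. F 0 (b k)) = of_real (s ^ (1 + l) * g_fun l n a b s)"
    using s by (simp add: F_def g_fun_def exp_of_real[symmetric])
  also have "(- of_real s :: complex) ^ Suc l = (-1) ^ (l + 1) * of_real (s ^ (1 + l))"
    by (simp add: power_minus[of "of_real s"])
  finally have "of_real (s ^ (1 + l)) * (LINT t|lborel. \<rho> t *\<^sub>R exp (- (complex_of_real s * of_real t))) =
      of_real (s ^ (1 + l)) * of_real (fact l * g_fun l n a b s)"
    by (simp add: mult_ac)
  moreover have "complex_of_real (s ^ (1 + l)) \<noteq> 0" using s by simp
  ultimately show ?thesis by (metis mult_left_cancel)
qed

text \<open>
  A translation by \<open>lam m\<close> multiplies the Laplace transform by \<open>exp (- lam m * s)\<close>, and the sum of these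
  factors is \<open>h_sum N lam s\<close>.
\<close>

lemma laplace_phi:
  assumes s: "s > 0"
  shows "(LINT t|lborel. \<phi> t *\<^sub>R exp (- (complex_of_real s * of_real t))) =
           of_real (fact l * h_sum N lam s * g_fun l n a b s)"
proof -
  obtain C where C: "\<And>t. t \<ge> 0 \<Longrightarrow> exp (- s * t) \<le> C / (1 + t) ^ Suc p"
    using exp_decay_bound[OF s] by blast
  have kernel: "(\<Sum>\<^sub>\<infinity>m\<in>index_set N. exp (- (complex_of_real s * of_real (t + lam m)))) =
      of_real (h_sum N lam s) * exp (- (complex_of_real s * of_real t))" for t
  proof -
    have "exp (- (complex_of_real s * of_real (t + lam m))) =
        exp (- (complex_of_real s * of_real t)) * of_real (exp (- lam m * s))" for m
      by (simp add: exp_of_real[symmetric] exp_add[symmetric] algebra_simps)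
    then have "(\<Sum>\<^sub>\<infinity>m\<in>index_set N. exp (- (complex_of_real s * of_real (t + lam m)))) =
        exp (- (complex_of_real s * of_real t)) * (\<Sum>\<^sub>\<infinity>m\<in>index_set N. of_real (exp (- lam m * s)))"
      by (simp only: infsum_cmult_right')
    also have "(\<Sum>\<^sub>\<infinity>m\<in>index_set N. complex_of_real (exp (- lam m * s))) = of_real (h_sum N lam s)"
      unfolding h_sum_def by (rule infsumI[OF has_sum_of_real[OF has_sum_infsum[OF exp_summable_on[OF s]]]])
    finally show ?thesis by (simp only: mult.commute)
  qed
  have "(LINT t|lborel. \<phi> t *\<^sub>R exp (- (complex_of_real s * of_real t))) =
      (LINT t|lborel. \<rho> t *\<^sub>R (\<Sum>\<^sub>\<infinity>m\<in>index_set N. exp (- (complex_of_real s * of_real (t + lam m)))))"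
    using C by (intro phi_integral) auto
  also have "\<dots> = (LINT t|lborel. \<rho> t *\<^sub>R (of_real (h_sum N lam s) * exp (- (complex_of_real s * of_real t))))"
    by (simp only: kernel)
  also have "\<dots> =
      of_real (h_sum N lam s) * (LINT t|lborel. \<rho> t *\<^sub>R exp (- (complex_of_real s * of_real t)))"
    by (simp only: mult_scaleR_right[symmetric] integral_mult_right_zero)
  also have "\<dots> = of_real (fact l * h_sum N lam s * g_fun l n a b s)"
    unfolding laplace_rho[OF s] by simp
  finally show ?thesis .
qed

text \<open>
  The constant comes from \<open>1 + t \<le> (1 + 1 / Re z) (Re z + t)\<close>.
\<close>

lemma cauchy_kernel_bound:
  assumes z: "Re z > 0" and t: "t \<ge> 0"
  shows "norm (1 / (z + of_real t) ^ Suc p) \<le> (1 + 1 / Re z) ^ Suc p / (1 + t) ^ Suc p"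
proof -
  have "1 + t \<le> (1 + 1 / Re z) * (Re z + t)"
    using z t by (simp add: field_simps)
  also have "\<dots> \<le> (1 + 1 / Re z) * norm (z + of_real t)"
    using z complex_Re_le_cmod[of "z + of_real t"] by (intro mult_left_mono) auto
  finally have "(1 + t) ^ Suc p \<le> (1 + 1 / Re z) ^ Suc p * norm (z + of_real t) ^ Suc p"
    using t by (subst power_mult_distrib[symmetric], intro power_mono) auto
  moreover have "norm (z + of_real t) > 0"
    using complex_Re_le_cmod[of "z + of_real t"] z t by auto
  ultimately have "1 / norm (z + of_real t) ^ Suc p \<le> (1 + 1 / Re z) ^ Suc p / (1 + t) ^ Suc p"
    using t by (simp add: divide_simps del: power_Suc)
  then show ?thesis by (simp only: norm_divide norm_power norm_one)
qed

lemma cauchy_kernel_measurable: "(\<lambda>t. 1 / (z + complex_of_real t) ^ Suc p) \<in> borel_measurable borel"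
  by measurable

lemma phi_cauchy_integrable:
  "Re z > 0 \<Longrightarrow> integrable lborel (\<lambda>t. \<phi> t *\<^sub>R (1 / (z + of_real t) ^ Suc p))"
  by (rule phi_integrable[OF cauchy_kernel_measurable cauchy_kernel_bound])

lemma laplace_eq_cauchy:
  assumes z: "Re z > 0"
  shows "set_integrable lborel {0<..}
           (\<lambda>s. exp (- of_real s * z) * of_real (s ^ p * h_sum N lam s * g_fun l n a b s))"
    and "(LINT s:{0<..}|lborel. exp (- of_real s * z) * of_real (s ^ p * h_sum N lam s * g_fun l n a b s)) =
           of_real (fact p / fact l) * (LINT t|lborel. \<phi> t *\<^sub>R (1 / (z + of_real t) ^ Suc p))"
proof -
  have eq: "of_real (s ^ p) * exp (- (of_real s * z)) * (LINT t|lborel. \<phi> t *\<^sub>R exp (- (complex_of_real s * of_real t))) =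
      fact l * (exp (- of_real s * z) * of_real (s ^ p * h_sum N lam s * g_fun l n a b s))" if "s \<in> {0<..}" for s
    using laplace_phi[of s] that by simp
  have zRe: "Re (of_real (Re z)) > 0" using z by simp
  have phi0: "\<And>t. t \<le> 0 \<Longrightarrow> \<phi> t = 0" by (rule phi_nonpos)
  note * = laplace_stieltjes_fubini[OF phi_measurable phi0 z phi_cauchy_integrable[OF z] phi_cauchy_integrable[OF zRe]]
  have "set_integrable lborel {0<..}
           (\<lambda>s. fact l * (exp (- of_real s * z) * of_real (s ^ p * h_sum N lam s * g_fun l n a b s)))"
    using *(1) by (rule set_integrable_cong[THEN iffD1, rotated -1]) (use eq in auto)
  then show "set_integrable lborel {0<..}
           (\<lambda>s. exp (- of_real s * z) * of_real (s ^ p * h_sum N lam s * g_fun l n a b s))"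
    by (simp only: set_integrable_mult_right_iff fact_nonzero if_False not_False_eq_True simp_thms)
  have "(LINT s:{0<..}|lborel. fact l * (exp (- of_real s * z) * of_real (s ^ p * h_sum N lam s * g_fun l n a b s)))
    = fact p * (LINT t|lborel. \<phi> t *\<^sub>R (1 / (z + of_real t) ^ Suc p))"
    by (rule trans[OF set_lebesgue_integral_cong *(2)]) (use eq in auto)
  then show "(LINT s:{0<..}|lborel. exp (- of_real s * z) * of_real (s ^ p * h_sum N lam s * g_fun l n a b s)) =
           of_real (fact p / fact l) * (LINT t|lborel. \<phi> t *\<^sub>R (1 / (z + of_real t) ^ Suc p))"
    by (simp add: field_simps)
qed

end

section \<open>The representation of the logarithm of the quotient\<close>

text \<open>
  The representing measure has density \<open>\<Phi>\<close> with respect to Lebesgue measure on the half-line.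
\<close>

lemma gen_stieltjes_density:
  fixes \<Phi> :: "real \<Rightarrow> real"
  assumes [measurable]: "\<Phi> \<in> borel_measurable borel" and pos: "\<And>t. \<Phi> t \<ge> 0" and \<Phi>0: "\<And>t. t \<le> 0 \<Longrightarrow> \<Phi> t = 0"
    and int: "\<And>x. x > 0 \<Longrightarrow> integrable lborel (\<lambda>t. \<Phi> t * (1 / (t + x) ^ Suc p))"
  shows "gen_stieltjes (real p + 1) (\<lambda>x. LINT t|lborel. \<Phi> t * (1 / (t + x) ^ Suc p))"
proof -
  define \<mu> where "\<mu> = density (restrict_space lborel {0..}) (\<lambda>t. ennreal (\<Phi> t))"
  have sets: "sets \<mu> = sets (restrict_space borel {0..})"
    by (simp add: \<mu>_def sets_restrict_space)
  have meas: "g \<in> borel_measurable (restrict_space lborel {0..})" if "g \<in> borel_measurable borel" for g :: "real \<Rightarrow> real"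
    using that by (intro measurable_restrict_space1) simp
  have eq: "indicator {0..} t *\<^sub>R (\<Phi> t *\<^sub>R (1 / (t + x) powr (real p + 1))) = \<Phi> t * (1 / (t + x) ^ Suc p)"
    if "x > 0" for x t
  proof (cases "t \<le> 0")
    case False
    have "(t + x) powr (real p + 1) = (t + x) ^ Suc p"
      using that False by (subst powr_realpow[symmetric]) (auto simp: add.commute)
    then show ?thesis using False by simp
  qed (simp add: \<Phi>0)
  have "integrable \<mu> (\<lambda>t. 1 / (t + x) powr (real p + 1)) \<and>
      (LINT t|lborel. \<Phi> t * (1 / (t + x) ^ Suc p)) = (LINT t|\<mu>. 1 / (t + x) powr (real p + 1)) + 0" if x: "x > 0" for x
  proof
    have m: "(\<lambda>t. 1 / (t + x) powr (real p + 1)) \<in> borel_measurable (restrict_space lborel {0..})"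
      by (rule meas) measurable
    have m\<Phi>: "\<Phi> \<in> borel_measurable (restrict_space lborel {0..})"
      by (rule meas) measurable
    show "integrable \<mu> (\<lambda>t. 1 / (t + x) powr (real p + 1))"
      unfolding \<mu>_def
      by (subst integrable_density[OF m m\<Phi>], use pos in simp, subst integrable_restrict_space)
         (use int[OF x] in \<open>simp_all only: eq[OF x], simp_all\<close>)
    show "(LINT t|lborel. \<Phi> t * (1 / (t + x) ^ Suc p)) = (LINT t|\<mu>. 1 / (t + x) powr (real p + 1)) + 0"
      unfolding \<mu>_def
      by (subst integral_density[OF m m\<Phi>], use pos in simp, subst integral_restrict_space)
         (simp_all only: eq[OF x], simp_all)
  qed
  then show ?thesis
    unfolding gen_stieltjes_def using sets by (intro conjI exI[of _ \<mu>] exI[of _ 0]) auto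
qed

lemma log_branch_field_derivative:
  assumes f: "f \<in> class_E p" and z: "z \<in> - \<real>\<^sub>\<le>\<^sub>0"
  shows "((deriv ^^ j) (log_branch f) has_field_derivative (deriv ^^ Suc j) (log_branch f) z) (at z)"
proof -
  have op: "open (- \<real>\<^sub>\<le>\<^sub>0 :: complex set)" by (intro open_Compl closed_nonpos_Reals_complex)
  have "(deriv ^^ j) (log_branch f) holomorphic_on - \<real>\<^sub>\<le>\<^sub>0"
    using is_log_branch_log_branch[OF f] op by (intro holomorphic_higher_deriv) (auto simp: is_log_branch_def)
  from holomorphic_derivI[OF this op z] show ?thesis by simp
qed

lemma add_nonneg_in_slit_plane:
  "Re z > 0 \<Longrightarrow> x \<ge> 0 \<Longrightarrow> z + of_real x \<in> - \<real>\<^sub>\<le>\<^sub>0"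
  by (auto simp: complex_nonpos_Reals_iff)

lemma higher_deriv_log_W:
  assumes f: "f \<in> class_E p" and a: "\<forall>k\<in>{1..n}. 0 \<le> a k" and b: "\<forall>k\<in>{1..n}. 0 \<le> b k"
    and z: "Re z > 0"
  shows "(deriv ^^ j) (log_W f n a b) z =
     (\<Sum>k=1..n. (deriv ^^ j) (log_branch f) (z + of_real (a k))) -
     (\<Sum>k=1..n. (deriv ^^ j) (log_branch f) (z + of_real (b k)))"
  using z
proof (induction j arbitrary: z)
  case 0
  show ?case by (simp add: log_W_def sum_subtractf)
next
  case (Suc j)
  let ?D = "\<lambda>j z. (\<Sum>k=1..n. (deriv ^^ j) (log_branch f) (z + of_real (a k))) -
     (\<Sum>k=1..n. (deriv ^^ j) (log_branch f) (z + of_real (b k)))"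
  have shift: "((\<lambda>z. (deriv ^^ j) (log_branch f) (z + of_real x)) has_field_derivative
      (deriv ^^ Suc j) (log_branch f) (z + of_real x)) (at z)" if "x \<ge> 0" for x
    using log_branch_field_derivative[OF f add_nonneg_in_slit_plane[OF Suc.prems that], of j]
    by (simp only: DERIV_shift)
  have "(?D j has_field_derivative ?D (Suc j) z) (at z)"
    by (intro DERIV_diff DERIV_sum shift) (use a b in auto)
  then have "((deriv ^^ j) (log_W f n a b) has_field_derivative ?D (Suc j) z) (at z)"
    by (rule has_field_derivative_transform_within_open[where S = "{z. Re z > 0}"])
       (use Suc in \<open>auto simp: open_halfspace_Re_gt\<close>)
  then show ?case using DERIV_imp_deriv by fastforce
qed

text \<open>
  Apply the Peano formula to \<open>F(t) = \<partial>\<^sup>p\<^sup>-\<^sup>l log f (z + t)\<close>.  Its derivative of order \<open>l + 1\<close> is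
  \<open>\<partial>\<^sup>p\<^sup>+\<^sup>1 log f (z + t)\<close>, a constant multiple of the sum over the zeros, and moving that sum over
  to \<open>\<rho>\<close> produces \<open>\<phi>\<close>.
\<close>

lemma (in matched_shifts) higher_deriv_log_W_eq_cauchy:
  assumes f: "f \<in> class_E p" and zeros: "lists_zeros f N lam" and lp: "l \<le> p" and z: "Re z > 0"
  shows "(-1) ^ (p - l + 1) * (deriv ^^ (p - l)) (log_W f n a b) z =
     of_real (fact p / fact l) * (LINT t|lborel. \<phi> t *\<^sub>R (1 / (z + of_real t) ^ Suc p))"
proof -
  define F where "F = (\<lambda>j t. (deriv ^^ (p - l + j)) (log_branch f) (z + of_real t))"
  define J where "J = (LINT t|lborel. \<phi> t *\<^sub>R (1 / (z + of_real t) ^ Suc p))"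
  have p1: "p \<ge> 1" using l1 lp by simp
  have "(F j has_vector_derivative F (Suc j) t) (at t)" if "0 \<le> t" for j t
  proof -
    have "((\<lambda>u. (deriv ^^ (p - l + j)) (log_branch f) (u + z)) has_field_derivative F (Suc j) t) (at (of_real t))"
      using log_branch_field_derivative[OF f add_nonneg_in_slit_plane[OF z that], of "p - l + j"]
      by (simp only: DERIV_shift F_def add.commute[of z] add_Suc_right)
    from has_vector_derivative_real_field[OF this] show ?thesis
      by (simp only: F_def add.commute[of z])
  qed
  from rho_peano[where F = F, OF this]
  have peano: "(LINT t|lborel. \<rho> t *\<^sub>R F (Suc l) t) =
      (-1) ^ (l + 1) * fact l * (deriv ^^ (p - l)) (log_W f n a b) z"
    by (simp add: F_def higher_deriv_log_W[OF f a0 b0 z])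
  have "(LINT t|lborel. \<rho> t *\<^sub>R F (Suc l) t) =
      (LINT t|lborel. (-1) ^ p * fact p * (\<rho> t *\<^sub>R (\<Sum>\<^sub>\<infinity>m\<in>index_set N. 1 / (z + of_real (t + lam m)) ^ Suc p)))"
  proof (intro Bochner_Integration.integral_cong refl)
    fix t
    show "\<rho> t *\<^sub>R F (Suc l) t = (-1) ^ p * fact p * (\<rho> t *\<^sub>R (\<Sum>\<^sub>\<infinity>m\<in>index_set N. 1 / (z + of_real (t + lam m)) ^ Suc p))"
    proof (cases "t \<le> 0")
      case False
      then have "Re (z + of_real t) > 0" using z by simp
      from higher_deriv_log_branch[OF f p1 zeros this]
      have "F (Suc l) t = (\<Sum>\<^sub>\<infinity>m\<in>index_set N. (-1) ^ p * fact p / (z + of_real t + of_real (lam m)) ^ Suc p)"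
        using lp by (simp add: F_def infsumI[symmetric] del: power_Suc funpow.simps)
      also have "\<dots> = (\<Sum>\<^sub>\<infinity>m\<in>index_set N. ((-1) ^ p * fact p) * (1 / (z + of_real (t + lam m)) ^ Suc p))"
        by (simp add: add.assoc)
      also have "\<dots> = ((-1) ^ p * fact p) * (\<Sum>\<^sub>\<infinity>m\<in>index_set N. 1 / (z + of_real (t + lam m)) ^ Suc p)"
        by (rule infsum_cmult_right')
      finally show ?thesis by simp
    qed (simp add: rho_nonpos)
  qed
  also have "\<dots> = (-1) ^ p * fact p * J"
  proof -
    have "J = (LINT t|lborel. \<rho> t *\<^sub>R (\<Sum>\<^sub>\<infinity>m\<in>index_set N. 1 / (z + of_real (t + lam m)) ^ Suc p))"
      unfolding J_def by (rule phi_integral[OF cauchy_kernel_measurable cauchy_kernel_bound[OF z]])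
    then show ?thesis by (simp only: integral_mult_right_zero)
  qed
  finally have peano': "(-1) ^ (l + 1) * fact l * (deriv ^^ (p - l)) (log_W f n a b) z = (-1) ^ p * fact p * J"
    unfolding peano .
  have sign: "(-1 :: complex) ^ (p - l + 1) = (-1) ^ (l + 1) * (-1) ^ p"
  proof -
    have "(-1 :: complex) ^ p = (-1) ^ (p - l) * (-1) ^ l" using lp by (simp flip: power_add)
    then show ?thesis by (simp add: mult_ac power_mult_distrib[symmetric])
  qed
  have "fact l * ((-1) ^ (p - l + 1) * (deriv ^^ (p - l)) (log_W f n a b) z) =
      (-1) ^ p * ((-1) ^ (l + 1) * fact l * (deriv ^^ (p - l)) (log_W f n a b) z)"
    unfolding sign by (simp only: mult_ac)
  also have "\<dots> = (-1) ^ p * ((-1) ^ p * fact p * J)"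
    unfolding peano' ..
  also have "\<dots> = fact p * J" by (simp add: mult.assoc[symmetric] power_mult_distrib[symmetric])
  finally show ?thesis unfolding J_def[symmetric] by (simp add: field_simps)
qed

theorem theorem1p3:
  fixes p l n :: nat and f :: "complex \<Rightarrow> complex" and N :: enat
    and lam a b :: "nat \<Rightarrow> real"
  assumes "1 \<le> p" and "1 \<le> l" and "l \<le> p"
    and "f \<in> class_E p"
    and "lists_zeros f N lam" and "mono_on (index_set N) lam"
    and "\<forall>m\<in>index_set N. 0 \<le> lam m"
    and "\<forall>k\<in>{1..n}. 0 \<le> a k" and "mono_on {1..n} a"
    and "\<forall>k\<in>{1..n}. 0 \<le> b k" and "mono_on {1..n} b"
    and "\<forall>j\<le>l. (\<Sum>k=1..n. a k ^ j) = (\<Sum>k=1..n. b k ^ j)"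
  shows "(\<forall>s>0. (\<lambda>m. exp (- lam m * s)) summable_on index_set N) \<and>
    (\<forall>t. (\<lambda>m. rho l n a b (t - lam m)) summable_on index_set N) \<and>
    (\<forall>z. Re z > 0 \<longrightarrow>
       set_integrable lborel {0<..}
         (\<lambda>s. exp (- of_real s * z) * of_real (s ^ p * h_sum N lam s * g_fun l n a b s)) \<and>
       set_integrable lborel {0<..}
         (\<lambda>t. of_real (phi N lam l n a b t) / (z + of_real t) ^ (p + 1)) \<and>
       (-1) ^ (p - l + 1) * (deriv ^^ (p - l)) (log_W f n a b) z
         = (LINT s:{0<..}|lborel.
              exp (- of_real s * z) * of_real (s ^ p * h_sum N lam s * g_fun l n a b s)) \<and>
       (LINT s:{0<..}|lborel.
          exp (- of_real s * z) * of_real (s ^ p * h_sum N lam s * g_fun l n a b s))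
         = of_real (Gamma (real p + 1) / fact l) *
             (LINT t:{0<..}|lborel. of_real (phi N lam l n a b t) / (z + of_real t) ^ (p + 1))) \<and>
    ((\<forall>t. 0 \<le> rho l n a b t) \<longrightarrow>
       gen_stieltjes_complex (real p + 1)
         (\<lambda>z. (-1) ^ (p - l + 1) * (deriv ^^ (p - l)) (log_W f n a b) z))"
proof -
  interpret matched_shifts p l n N lam a b
    using assms class_E_zeros_summable[of f p N lam] by unfold_locales auto
  note main = higher_deriv_log_W_eq_cauchy[OF assms(4,5,3)]
  \<comment> \<open>\<open>\<phi>\<close> vanishes on the negative half-line and at \<open>0\<close>, so the integrals run over the whole line\<close>
  have half_line: "indicator {0<..} t *\<^sub>R (of_real (\<phi> t) / (z + of_real t) ^ (p + 1)) =
      \<phi> t *\<^sub>R (1 / (z + of_real t) ^ Suc p)" for t and z :: complex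
    using phi_nonpos[of t] by (cases "t \<le> 0") (auto simp: scaleR_conv_of_real)
  have Gamma_p: "Gamma (real p + 1) = fact p"
    using Gamma_fact[of p, where 'a = real] by (simp add: add.commute)
  have cauchy_int: "set_integrable lborel {0<..} (\<lambda>t. of_real (\<phi> t) / (z + of_real t) ^ (p + 1))" if "Re z > 0" for z
    using phi_cauchy_integrable[OF that] by (simp only: set_integrable_def half_line)
  have stieltjes: "gen_stieltjes_complex (real p + 1)
         (\<lambda>z. (-1) ^ (p - l + 1) * (deriv ^^ (p - l)) (log_W f n a b) z)"
    if rho: "\<forall>t. 0 \<le> \<rho> t"
  proof -
    define \<Phi> where "\<Phi> = (\<lambda>t. fact p / fact l * \<phi> t)"
    have kernel: "(fact p / fact l * complex_of_real (\<phi> t)) * (1 / (of_real x + of_real t) ^ Suc p) =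
        of_real (\<Phi> t * (1 / (t + x) ^ Suc p))" for x t
      by (simp add: \<Phi>_def add.commute)
    have pos: "\<phi> t \<ge> 0" for t
      unfolding phi_def using rho by (intro infsum_nonneg) auto
    have cint: "integrable lborel (\<lambda>t. complex_of_real (\<Phi> t * (1 / (t + x) ^ Suc p)))" if "x > 0" for x
    proof -
      have "integrable lborel (\<lambda>t. (fact p / fact l) * (\<phi> t *\<^sub>R (1 / (complex_of_real x + of_real t) ^ Suc p)))"
        using that by (intro integrable_mult_right phi_cauchy_integrable) auto
      then show ?thesis by (simp only: kernel[symmetric] scaleR_conv_of_real mult.assoc)
    qed
    have "gen_stieltjes (real p + 1) (\<lambda>x. LINT t|lborel. \<Phi> t * (1 / (t + x) ^ Suc p))"
    proof (rule gen_stieltjes_density)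
      show "\<Phi> \<in> borel_measurable borel" unfolding \<Phi>_def by measurable
      show "integrable lborel (\<lambda>t. \<Phi> t * (1 / (t + x) ^ Suc p))" if "x > 0" for x
        using cint[OF that] by (simp only: complex_of_real_integrable_eq)
    qed (auto simp: \<Phi>_def pos phi_nonpos)
    moreover have "(-1) ^ (p - l + 1) * (deriv ^^ (p - l)) (log_W f n a b) (of_real x) =
        of_real (LINT t|lborel. \<Phi> t * (1 / (t + x) ^ Suc p))" if "x > 0" for x
    proof -
      have "(-1) ^ (p - l + 1) * (deriv ^^ (p - l)) (log_W f n a b) (of_real x) =
          of_real (fact p / fact l) * (LINT t|lborel. \<phi> t *\<^sub>R (1 / (of_real x + of_real t) ^ Suc p))"
        using that by (intro main) auto
      also have "\<dots> = (LINT t|lborel. (fact p / fact l) * (\<phi> t *\<^sub>R (1 / (complex_of_real x + of_real t) ^ Suc p)))"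
        by (simp only: integral_mult_right_zero of_real_divide of_real_fact)
      also have "\<dots> = (LINT t|lborel. of_real (\<Phi> t * (1 / (t + x) ^ Suc p)))"
        by (simp only: kernel[symmetric] scaleR_conv_of_real mult.assoc)
      finally show ?thesis by (simp only: integral_complex_of_real)
    qed
    ultimately show ?thesis
      unfolding gen_stieltjes_complex_def by blast
  qed
  have eq: "(LINT t:{0<..}|lborel. of_real (\<phi> t) / (z + of_real t) ^ (p + 1)) =
      (LINT t|lborel. \<phi> t *\<^sub>R (1 / (z + of_real t) ^ Suc p))" for z :: complex
    by (simp only: set_lebesgue_integral_def half_line)
  show ?thesis
    unfolding Gamma_p eq
    by (intro conjI allI impI exp_summable_on rho_summable_on cauchy_int laplace_eq_cauchy stieltjes)
       (simp_all only: main laplace_eq_cauchy(2))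
qed

end
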